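(* Let $h(n,k)$ denote the number of nonisomorphic $k$-element graded posets $P$ of rank $n$ with $\hat0$ and $\hat1$ for which the flag $h$-vector $\beta_P$ is multiplicity-free. Let $$U(x,y)=\sum_{n\ge1}\sum_{k\ge2}h(n,k)x^ny^k.$$ Then $$U(x,y)=\frac{xy^2(1-xy^2)(1-3xy^2)}{1-xy-5xy^2+4x^2y^3+5x^2y^4-3x^3y^5}.$$
   Context: For a finite graded poset $P$ of rank $n$ with $\hat0,\hat1$ and rank function $\rho$, the flag $f$-vector is $\alpha_P(S)=$ number of chains $C$ of $P$ with $\{\rho(t):t\in C\}=S$, for $S\subseteq[n-1]$, and the flag $h$-vector is $\beta_P(S)=\sum_{T\subseteq S}(-1)^{\#(S-T)}\alpha_P(T)$. $\beta_P$ is multiplicity-free if $\beta_P(S)\in\{0,1,-1\}$ for all $S\subseteq[n-1]$. *)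

theory Defs
  imports Complex_Main "HOL-Computational_Algebra.Formal_Power_Series"
begin

text \<open>
  A finite poset is a relation \<open>r\<close> (\<open>(x, y) \<in> r\<close> meaning \<open>x \<le> y\<close>) with \<open>Partial_order r\<close>; its set
  of elements is \<open>Field r\<close>. The library set \<open>Chains r\<close> contains the empty chain, and its members are
  subsets of \<open>Field r\<close>.
\<close>

definition maximal_chain :: "'a rel \<Rightarrow> 'a set \<Rightarrow> bool" where
  "maximal_chain r C \<longleftrightarrow> C \<in> Chains r \<and> (\<forall>D \<in> Chains r. C \<subseteq> D \<longrightarrow> D = C)"

definition graded_poset :: "nat \<Rightarrow> 'a rel \<Rightarrow> bool" where
  "graded_poset n r \<longleftrightarrow>
     finite (Field r) \<and> Partial_order r \<and> (\<forall>C. maximal_chain r C \<longrightarrow> card C = n + 1)"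

definition has_bot :: "'a rel \<Rightarrow> bool" where
  "has_bot r \<longleftrightarrow> (\<exists>z \<in> Field r. \<forall>x \<in> Field r. (z, x) \<in> r)"

definition has_top :: "'a rel \<Rightarrow> bool" where
  "has_top r \<longleftrightarrow> (\<exists>u \<in> Field r. \<forall>x \<in> Field r. (x, u) \<in> r)"

text \<open>
  The rank of \<open>t\<close> is the length (number of elements minus one) of a longest chain of elements
  \<open>\<le> t\<close>. The lemmas \<open>poset_rank_minimal\<close> and \<open>poset_rank_cover\<close> below show that on a graded poset
  this is the usual rank function.
\<close>

definition poset_rank :: "'a rel \<Rightarrow> 'a \<Rightarrow> nat" where
  "poset_rank r t = Max {card C - 1 | C. C \<in> Chains r \<and> C \<subseteq> under r t}"

definition flag_f :: "'a rel \<Rightarrow> nat set \<Rightarrow> nat" where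
  "flag_f r S = card {C \<in> Chains r. poset_rank r ` C = S}"

definition flag_h :: "'a rel \<Rightarrow> nat set \<Rightarrow> int" where
  "flag_h r S = (\<Sum>T \<in> Pow S. (-1) ^ card (S - T) * int (flag_f r T))"

definition flag_h_multiplicity_free :: "nat \<Rightarrow> 'a rel \<Rightarrow> bool" where
  "flag_h_multiplicity_free n r \<longleftrightarrow> (\<forall>S \<subseteq> {1..<n}. flag_h r S \<in> {0, 1, -1})"

definition poset_iso :: "'a rel \<Rightarrow> 'b rel \<Rightarrow> bool" where
  "poset_iso r s \<longleftrightarrow> (\<exists>f. bij_betw f (Field r) (Field s) \<and>
     (\<forall>x \<in> Field r. \<forall>y \<in> Field r. (x, y) \<in> r \<longleftrightarrow> (f x, f y) \<in> s))"

text \<open>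
  Every \<open>k\<close>-element poset is isomorphic to one with set of elements \<open>{..<k}\<close> (lemma
  \<open>poset_iso_standard_carrier\<close>), so isomorphism types are counted on this carrier.
\<close>

definition mf_posets :: "nat \<Rightarrow> nat \<Rightarrow> nat rel set" where
  "mf_posets n k = {r. Field r = {..<k} \<and> graded_poset n r \<and> has_bot r \<and> has_top r \<and>
     flag_h_multiplicity_free n r}"

definition num_mf_posets :: "nat \<Rightarrow> nat \<Rightarrow> nat" where
  "num_mf_posets n k =
     card (mf_posets n k // {(r, s). r \<in> mf_posets n k \<and> s \<in> mf_posets n k \<and> poset_iso r s})"

text \<open>
  Power series in \<open>x\<close> and \<open>y\<close> are power series in \<open>x\<close> whose coefficients are power series in \<open>y\<close>.
\<close>

definition varx :: "rat fps fps" where "varx = fps_X"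

definition vary :: "rat fps fps" where "vary = fps_const fps_X"

definition U_series :: "rat fps fps" where
  "U_series = Abs_fps (\<lambda>n. Abs_fps (\<lambda>k.
     if n \<ge> 1 \<and> k \<ge> 2 then of_nat (num_mf_posets n k) else 0))"


subsection \<open>Adequacy of the definitions\<close>

lemma U_series_nth:
  "fps_nth (fps_nth U_series n) k = (if n \<ge> 1 \<and> k \<ge> 2 then of_nat (num_mf_posets n k) else 0)"
  by (simp add: U_series_def)

lemma vars_monomial_nth:
  "fps_nth (fps_nth (varx ^ i * vary ^ j) n) k = (if n = i \<and> k = j then 1 else 0)"
  by (simp add: varx_def vary_def fps_X_power_mult_nth fps_const_power)

text \<open>
  The coefficient ring \<open>rat fps\<close> is not a field, but division by a series whose constant term with
  respect to \<open>x\<close> is 1 is genuine division.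
\<close>

lemma fps_fps_divide_cancel:
  fixes f g :: "rat fps fps"
  assumes "fps_nth g 0 = 1"
  shows "f / g * g = f"
proof -
  have sd: "subdegree g = 0" using assms by simp
  have "g * inverse g = 1"
    using fps_right_inverse[of g "inverse (fps_nth g 0)"] assms
    by (simp add: fps_inverse_def[of g])
  then have "inverse g * g = 1" by (simp only: mult.commute)
  then show ?thesis
    by (simp add: fps_divide_def sd mult.assoc)
qed

lemma equiv_poset_iso:
  "equiv A {(r :: 'a rel, s). r \<in> A \<and> s \<in> A \<and> poset_iso r s}"
proof (rule equivI)
  show "refl_on A {(r, s). r \<in> A \<and> s \<in> A \<and> poset_iso r s}"
    by (auto simp: refl_on_def poset_iso_def intro!: exI[of _ id])
  show "sym {(r, s). r \<in> A \<and> s \<in> A \<and> poset_iso r s}"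
  proof (rule symI, clarsimp)
    fix r s :: "'a rel" assume "poset_iso r s"
    then obtain f where f: "bij_betw f (Field r) (Field s)"
      "\<forall>x \<in> Field r. \<forall>y \<in> Field r. (x, y) \<in> r \<longleftrightarrow> (f x, f y) \<in> s"
      unfolding poset_iso_def by blast
    let ?g = "inv_into (Field r) f"
    have "bij_betw ?g (Field s) (Field r)" using f(1) by (rule bij_betw_inv_into)
    moreover have "(x, y) \<in> s \<longleftrightarrow> (?g x, ?g y) \<in> r" if "x \<in> Field s" "y \<in> Field s" for x y
    proof -
      have "?g x \<in> Field r" "?g y \<in> Field r" "f (?g x) = x" "f (?g y) = y"
        using that f(1) by (auto simp: bij_betw_def inv_into_into f_inv_into_f)
      then show ?thesis using f(2) by metis
    qed
    ultimately show "poset_iso s r" unfolding poset_iso_def by blast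
  qed
  show "trans {(r, s). r \<in> A \<and> s \<in> A \<and> poset_iso r s}"
  proof (rule transI, clarsimp)
    fix r s t :: "'a rel" assume "poset_iso r s" "poset_iso s t"
    then obtain f g where f: "bij_betw f (Field r) (Field s)"
      "\<forall>x \<in> Field r. \<forall>y \<in> Field r. (x, y) \<in> r \<longleftrightarrow> (f x, f y) \<in> s"
      and g: "bij_betw g (Field s) (Field t)"
      "\<forall>x \<in> Field s. \<forall>y \<in> Field s. (x, y) \<in> s \<longleftrightarrow> (g x, g y) \<in> t"
      unfolding poset_iso_def by blast
    have "bij_betw (g \<circ> f) (Field r) (Field t)" using f(1) g(1) by (rule bij_betw_trans)
    moreover have "\<forall>x \<in> Field r. \<forall>y \<in> Field r. (x, y) \<in> r \<longleftrightarrow> ((g \<circ> f) x, (g \<circ> f) y) \<in> t"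
      using f(2) g(2) bij_betwE[OF f(1)] by simp
    ultimately show "poset_iso r t" unfolding poset_iso_def by blast
  qed
qed auto

lemma poset_iso_standard_carrier:
  fixes r :: "'a rel"
  assumes "finite (Field r)" "Partial_order r" "card (Field r) = k"
  obtains s :: "nat rel" where "Field s = {..<k}" "Partial_order s" "poset_iso r s"
proof -
  obtain f where f: "bij_betw f (Field r) {..<k}"
    using assms(1,3) by (metis bij_betw_iff_card card_lessThan finite_lessThan)
  define s where "s = (\<lambda>(x, y). (f x, f y)) ` r"
  have refl: "(x, x) \<in> r" if "x \<in> Field r" for x
    using assms(2) that by (auto simp: partial_order_on_def preorder_on_def refl_on_def)
  have inj: "inj_on f (Field r)" and im: "f ` Field r = {..<k}" using f by (auto simp: bij_betw_def)
  have mem: "(x, y) \<in> r \<longleftrightarrow> (f x, f y) \<in> s" if "x \<in> Field r" "y \<in> Field r" for x y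
  proof
    assume "(f x, f y) \<in> s"
    then obtain a b where ab: "(a, b) \<in> r" "f a = f x" "f b = f y" by (auto simp: s_def)
    then have "a = x" "b = y" using inj that by (auto simp: inj_on_def dest: FieldI1 FieldI2)
    with ab show "(x, y) \<in> r" by simp
  qed (force simp: s_def)
  have fld: "Field s = {..<k}"
  proof -
    have "Field s = f ` Field r" by (force simp: s_def Field_def)
    then show ?thesis using im by simp
  qed
  have tr: "trans r" and an: "antisym r"
    using assms(2) by (auto simp: partial_order_on_def preorder_on_def)
  have pre: "\<exists>x\<in>Field r. u = f x" if "u \<in> Field s" for u using that fld im by auto
  have "refl_on (Field s) s"
    using pre mem refl by (metis refl_onI)
  moreover have "trans s"
  proof (rule transI)
    fix u v w assume uv: "(u, v) \<in> s" and vw: "(v, w) \<in> s"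
    then obtain x y z where "x \<in> Field r" "y \<in> Field r" "z \<in> Field r" "u = f x" "v = f y" "w = f z"
      using pre by (meson FieldI1 FieldI2)
    then show "(u, w) \<in> s" using uv vw mem tr by (meson transD)
  qed
  moreover have "antisym s"
  proof (rule antisymI)
    fix u v assume uv: "(u, v) \<in> s" and vu: "(v, u) \<in> s"
    then obtain x y where "x \<in> Field r" "y \<in> Field r" "u = f x" "v = f y"
      using pre by (meson FieldI1 FieldI2)
    then show "u = v" using uv vu mem an by (metis antisymD)
  qed
  moreover have "s \<subseteq> Field s \<times> Field s" by (auto intro: FieldI1 FieldI2)
  ultimately have "Partial_order s" by (simp add: partial_order_on_def preorder_on_def)
  moreover have "poset_iso r s"
    unfolding poset_iso_def using f fld mem by auto
  ultimately show ?thesis using that fld by blast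
qed

lemma Chains_subset_Field: "C \<in> Chains r \<Longrightarrow> C \<subseteq> Field r"
  by (auto simp: Chains_def intro: FieldI1)

lemma finite_Chains: "finite (Field r) \<Longrightarrow> finite (Chains r)"
  by (rule finite_subset[of _ "Pow (Field r)"]) (auto dest: Chains_subset_Field)

text \<open>A longest chain below \<open>t\<close> is a maximal chain of the principal order ideal of \<open>t\<close>.\<close>

lemma longest_chain_below:
  assumes fin: "finite (Field r)" and po: "Partial_order r" and t: "t \<in> Field r"
  obtains C where "C \<in> Chains r" "C \<subseteq> under r t" "t \<in> C" "card C = poset_rank r t + 1"
    "\<And>x. (x, t) \<in> r \<Longrightarrow> \<forall>y\<in>C. (x, y) \<in> r \<or> (y, x) \<in> r \<Longrightarrow> x \<in> C"
proof -
  let ?K = "{C. C \<in> Chains r \<and> C \<subseteq> under r t}"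
  let ?N = "{card C - 1 | C. C \<in> Chains r \<and> C \<subseteq> under r t}"
  have refl: "(x, x) \<in> r" if "x \<in> Field r" for x
    using po that by (auto simp: partial_order_on_def preorder_on_def refl_on_def)
  have finK: "finite ?K" using finite_Chains[OF fin] by simp
  have N: "?N = (\<lambda>C. card C - 1) ` ?K" by auto
  have tK: "{t} \<in> ?K" using refl[OF t] by (auto simp: Chains_def under_def)
  have Max: "poset_rank r t \<in> ?N" unfolding poset_rank_def
    by (rule Max_in) (use finK tK N in auto)
  have ub: "card C - 1 \<le> poset_rank r t" if "C \<in> ?K" for C
    unfolding poset_rank_def by (rule Max_ge) (use finK N that in auto)
  have ext: "insert x C \<in> ?K"
    if "C \<in> ?K" "(x, t) \<in> r" "\<forall>y\<in>C. (x, y) \<in> r \<or> (y, x) \<in> r" for x C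
    using that refl[of x] by (auto simp: Chains_def under_def intro: FieldI1)
  have extt: "insert t C \<in> ?K" if "C \<in> ?K" for C
    using that by (intro ext) (auto simp: under_def refl[OF t])
  have finC: "finite C" if "C \<in> ?K" for C
    using that Chains_subset_Field[of C r] finite_subset[OF _ fin] by auto
  obtain C0 where C0: "C0 \<in> ?K" "card C0 - 1 = poset_rank r t" using Max by auto
  define C where "C = insert t C0"
  have C: "C \<in> ?K" "t \<in> C" using extt[OF C0(1)] by (auto simp: C_def)
  have pos: "card C > 0" using C finC[OF C(1)] by (auto simp: card_gt_0_iff)
  have "card C0 \<le> card C" unfolding C_def by (rule card_insert_le)
  then have cC: "card C = poset_rank r t + 1" using C0(2) ub[OF C(1)] pos by linarith
  have mx: "x \<in> C" if x: "(x, t) \<in> r" "\<forall>y\<in>C. (x, y) \<in> r \<or> (y, x) \<in> r" for x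
  proof (rule ccontr)
    assume "x \<notin> C"
    then have "card (insert x C) = poset_rank r t + 2" using cC finC[OF C(1)] by simp
    then show False using ub[OF ext[OF C(1) x]] by simp
  qed
  show ?thesis using that[of C] C cC mx by blast
qed

lemma longest_chain_above:
  assumes fin: "finite (Field r)" and po: "Partial_order r" and t: "t \<in> Field r"
  obtains C where "C \<in> Chains r" "\<And>y. y \<in> C \<Longrightarrow> (t, y) \<in> r" "t \<in> C"
    "\<And>x. (t, x) \<in> r \<Longrightarrow> \<forall>y\<in>C. (x, y) \<in> r \<or> (y, x) \<in> r \<Longrightarrow> x \<in> C"
proof -
  have "finite (Field (r\<inverse>))" "Partial_order (r\<inverse>)" "t \<in> Field (r\<inverse>)" using assms by auto
  from longest_chain_below[OF this] obtain C where C: "C \<in> Chains (r\<inverse>)" "C \<subseteq> under (r\<inverse>) t" "t \<in> C"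
    "\<And>x. (x, t) \<in> r\<inverse> \<Longrightarrow> \<forall>y\<in>C. (x, y) \<in> r\<inverse> \<or> (y, x) \<in> r\<inverse> \<Longrightarrow> x \<in> C" by metis
  show ?thesis
  proof (rule that[of C])
    show "C \<in> Chains r" using C(1) by (auto simp: Chains_def)
    show "(t, y) \<in> r" if "y \<in> C" for y using C(2) that by (auto simp: under_def)
    show "t \<in> C" by fact
    show "x \<in> C" if "(t, x) \<in> r" "\<forall>y\<in>C. (x, y) \<in> r \<or> (y, x) \<in> r" for x
      using C(4)[of x] that by auto
  qed
qed

lemma poset_rank_minimal:
  assumes "finite (Field r)" "Partial_order r" "t \<in> Field r" "\<And>x. (x, t) \<in> r \<Longrightarrow> x = t"
  shows "poset_rank r t = 0"
proof -
  obtain C where C: "C \<subseteq> under r t" "t \<in> C" "card C = poset_rank r t + 1"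
    using longest_chain_below[OF assms(1-3)] by metis
  then have "C = {t}" using assms(4) by (auto simp: under_def)
  then show ?thesis using C(3) by simp
qed

lemma poset_rank_cover:
  assumes gr: "graded_poset n r" and st: "(s, t) \<in> r" "s \<noteq> t"
    and cover: "\<And>x. (s, x) \<in> r \<Longrightarrow> (x, t) \<in> r \<Longrightarrow> x = s \<or> x = t"
  shows "poset_rank r t = poset_rank r s + 1"
proof -
  have fin: "finite (Field r)" and po: "Partial_order r"
    and len: "\<And>C. maximal_chain r C \<Longrightarrow> card C = n + 1"
    using gr by (auto simp: graded_poset_def)
  have tr: "trans r" and an: "antisym r"
    using po by (auto simp: partial_order_on_def preorder_on_def)
  have s: "s \<in> Field r" and t: "t \<in> Field r" using st by (auto intro: FieldI1 FieldI2)
  obtain C where C: "C \<in> Chains r" "C \<subseteq> under r s" "s \<in> C" "card C = poset_rank r s + 1"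
    "\<And>x. (x, s) \<in> r \<Longrightarrow> \<forall>y\<in>C. (x, y) \<in> r \<or> (y, x) \<in> r \<Longrightarrow> x \<in> C"
    using longest_chain_below[OF fin po s] by metis
  obtain D where D: "D \<in> Chains r" "D \<subseteq> under r t" "t \<in> D" "card D = poset_rank r t + 1"
    "\<And>x. (x, t) \<in> r \<Longrightarrow> \<forall>y\<in>D. (x, y) \<in> r \<or> (y, x) \<in> r \<Longrightarrow> x \<in> D"
    using longest_chain_below[OF fin po t] by metis
  obtain E where E: "E \<in> Chains r" "\<And>y. y \<in> E \<Longrightarrow> (t, y) \<in> r" "t \<in> E"
    "\<And>x. (t, x) \<in> r \<Longrightarrow> \<forall>y\<in>E. (x, y) \<in> r \<or> (y, x) \<in> r \<Longrightarrow> x \<in> E"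
    using longest_chain_above[OF fin po t] by metis
  have Cs: "\<And>y. y \<in> C \<Longrightarrow> (y, s) \<in> r" and Dt: "\<And>y. y \<in> D \<Longrightarrow> (y, t) \<in> r"
    using C(2) D(2) by (auto simp: under_def)
  have ce: "(y, z) \<in> r" if "y \<in> C" "z \<in> E" for y z
    using transD[OF tr Cs[OF that(1)] transD[OF tr st(1) E(2)[OF that(2)]]] .
  have de: "(y, z) \<in> r" if "y \<in> D" "z \<in> E" for y z
    using transD[OF tr Dt[OF that(1)] E(2)[OF that(2)]] .
  have "maximal_chain r (C \<union> E)" unfolding maximal_chain_def
  proof (intro conjI ballI impI)
    show "C \<union> E \<in> Chains r" using C(1) E(1) ce by (auto simp: Chains_def)
    fix F assume F: "F \<in> Chains r" "C \<union> E \<subseteq> F"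
    have "x \<in> C \<union> E" if x: "x \<in> F" for x
    proof -
      have cmp: "(x, y) \<in> r \<or> (y, x) \<in> r" if "y \<in> C \<union> E" for y
        using F x that unfolding Chains_def by blast
      have "(x, s) \<in> r \<or> (s, x) \<in> r" "(x, t) \<in> r \<or> (t, x) \<in> r" using cmp C(3) E(3) by auto
      then consider "(x, s) \<in> r" | "(t, x) \<in> r" | "(s, x) \<in> r" "(x, t) \<in> r" by blast
      then show ?thesis
      proof cases
        case 1 then show ?thesis using C(5)[of x] cmp by blast
      next
        case 2 then show ?thesis using E(4)[of x] cmp by blast
      next
        case 3 then show ?thesis using cover C(3) E(3) by blast
      qed
    qed
    then show "F = C \<union> E" using F(2) by blast
  qed
  then have 1: "card (C \<union> E) = n + 1" by (rule len)
  have "maximal_chain r (D \<union> E)" unfolding maximal_chain_def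
  proof (intro conjI ballI impI)
    show "D \<union> E \<in> Chains r" using D(1) E(1) de by (auto simp: Chains_def)
    fix F assume F: "F \<in> Chains r" "D \<union> E \<subseteq> F"
    have "x \<in> D \<union> E" if x: "x \<in> F" for x
    proof -
      have cmp: "(x, y) \<in> r \<or> (y, x) \<in> r" if "y \<in> D \<union> E" for y
        using F x that unfolding Chains_def by blast
      then have "(x, t) \<in> r \<or> (t, x) \<in> r" using E(3) by auto
      then show ?thesis using D(5)[of x] E(4)[of x] cmp by blast
    qed
    then show "F = D \<union> E" using F(2) by blast
  qed
  then have 2: "card (D \<union> E) = n + 1" by (rule len)
  have finCDE: "finite C" "finite D" "finite E"
    using C(1) D(1) E(1) Chains_subset_Field finite_subset[OF _ fin] by blast+
  have "C \<inter> E = {}"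
  proof (rule ccontr)
    assume "C \<inter> E \<noteq> {}"
    then obtain x where "(x, s) \<in> r" "(t, x) \<in> r" using Cs E(2) by blast
    then have "(t, s) \<in> r" using tr by (meson transD)
    then show False using st an by (meson antisymD)
  qed
  then have 3: "card (C \<union> E) = card C + card E" using finCDE by (simp add: card_Un_disjoint)
  have "D \<inter> E = {t}" using D(3) E(2,3) Dt an by (auto dest: antisymD)
  then have 4: "card (D \<union> E) + 1 = card D + card E"
    using card_Un_Int[of D E] finCDE by simp
  show ?thesis using 1 2 3 4 C(4) D(4) by linarith
qed

end

theory Submission
  imports Defs
begin

text \<open>
  Since \<open>\<beta>({i})\<close> is the size of level \<open>i\<close> minus 1, all levels of a multiplicity-free poset have at
  most two elements. This is also sufficient: up to sign, \<open>\<beta>(S)\<close> is a reduced Euler characteristic,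
  and removing the lowest level in \<open>S\<close> multiplies it by \<open>1 - c\<close>, where \<open>c \<le> 2\<close> is the number of its
  elements that lie below the whole next level in \<open>S\<close>.
  The isomorphism types of such posets are the words accepted by a finite automaton which reads the
  levels from bottom to top. It remembers whether the current level has one element, two elements
  that an automorphism of the part read so far can swap, or two elements that are distinguishable.
  With \<open>A\<close>, \<open>S\<close>, \<open>B\<close> the generating functions of these three states,
  \<open>A = y + x y (A + S + B)\<close>, \<open>S = x y\<^sup>2 (A + 2 S + B)\<close>, \<open>B = x y\<^sup>2 (S + 3 B)\<close> and \<open>U = A - y\<close>.
\<close>

section \<open>Ranked posets\<close>

text \<open>The rank function is a parameter and \<open>ex_cover\<close> replaces the condition on
  maximal chains, so that code posets (with \<open>fst\<close>) and isomorphic copies (with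
  \<open>rk \<circ> f\<close>) can be checked directly. By \<open>graded\<close>,
  \<open>has_bot\<close>, \<open>has_top\<close> and \<open>ranked_poset_poset_rank\<close> these
  are exactly the graded posets of rank \<open>n\<close> with bottom and top.\<close>

locale ranked_poset =
  fixes r :: "'a rel" and n :: nat and rk :: "'a \<Rightarrow> nat"
  assumes finite_Field: "finite (Field r)"
    and partial_order: "Partial_order r"
    and bot: "\<exists>z\<in>Field r. rk z = 0 \<and> (\<forall>x\<in>Field r. (z, x) \<in> r)"
    and top: "\<exists>u\<in>Field r. rk u = n \<and> (\<forall>x\<in>Field r. (x, u) \<in> r)"
    and rk_less: "(x, y) \<in> r \<Longrightarrow> x \<noteq> y \<Longrightarrow> rk x < rk y"
    and ex_cover: "(x, y) \<in> r \<Longrightarrow> x \<noteq> y \<Longrightarrow> \<exists>z. (x, z) \<in> r \<and> (z, y) \<in> r \<and> rk z = Suc (rk x)"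
begin

definition level :: "nat \<Rightarrow> 'a set" where
  "level i = {x \<in> Field r. rk x = i}"

lemma refl: "x \<in> Field r \<Longrightarrow> (x, x) \<in> r"
  using partial_order by (auto simp: partial_order_on_def preorder_on_def refl_on_def)

lemma trans: "(x, y) \<in> r \<Longrightarrow> (y, z) \<in> r \<Longrightarrow> (x, z) \<in> r"
  using partial_order by (auto simp: partial_order_on_def preorder_on_def dest: transD)

lemma antisym: "(x, y) \<in> r \<Longrightarrow> (y, x) \<in> r \<Longrightarrow> x = y"
  using partial_order by (auto simp: partial_order_on_def dest: antisymD)

lemma rk_le: "(x, y) \<in> r \<Longrightarrow> rk x \<le> rk y"
  using rk_less by (cases "x = y") (auto simp: less_imp_le)

lemma rk_le_n: "x \<in> Field r \<Longrightarrow> rk x \<le> n"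
  using top rk_le by blast

text \<open>\<open>ex_cover\<close> climbs from \<open>x\<close> one rank at a time while staying
  below \<open>y\<close>.\<close>

lemma interpolate:
  assumes "(x, y) \<in> r" "rk x \<le> i" "i \<le> rk y"
  shows "\<exists>z. (x, z) \<in> r \<and> (z, y) \<in> r \<and> rk z = i"
  using assms
proof (induction "i - rk x" arbitrary: x)
  case 0
  then have "rk x = i" by simp
  then show ?case using 0 refl[of x] by (auto intro: FieldI1)
next
  case (Suc m)
  then have "x \<noteq> y" by auto
  then obtain z where z: "(x, z) \<in> r" "(z, y) \<in> r" "rk z = Suc (rk x)"
    using ex_cover Suc.prems(1) by blast
  have "m = i - rk z" "rk z \<le> i" using z(3) Suc.hyps(2) by simp_all
  then obtain z' where "(z, z') \<in> r" "(z', y) \<in> r" "rk z' = i"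
    using Suc.hyps(1)[of z] z(2) Suc.prems(3) by blast
  then show ?case using z(1) trans by blast
qed

lemma ex_below:
  assumes "x \<in> Field r" "i \<le> rk x"
  shows "\<exists>z\<in>level i. (z, x) \<in> r"
proof -
  obtain b where b: "b \<in> Field r" "rk b = 0" "(b, x) \<in> r" using bot assms(1) by blast
  then show ?thesis using interpolate[of b x i] assms(2) by (auto simp: level_def intro: FieldI1)
qed

lemma ex_above:
  assumes "x \<in> Field r" "rk x \<le> i" "i \<le> n"
  shows "\<exists>z\<in>level i. (x, z) \<in> r"
proof -
  obtain u where u: "u \<in> Field r" "rk u = n" "(x, u) \<in> r" using top assms(1) by blast
  then show ?thesis using interpolate[of x u i] assms by (auto simp: level_def intro: FieldI1)
qed

lemma finite_level: "finite (level i)"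
  using finite_Field by (simp add: level_def)

lemma level_eq_empty_iff: "level i = {} \<longleftrightarrow> n < i"
proof
  assume "level i = {}"
  show "n < i"
  proof (rule ccontr)
    assume "\<not> n < i"
    moreover obtain z where "z \<in> Field r" "rk z = 0" using bot by blast
    ultimately show False using ex_above[of z i] \<open>level i = {}\<close> by auto
  qed
qed (use rk_le_n in \<open>force simp: level_def\<close>)

lemma level_0: "\<exists>z. level 0 = {z}"
proof -
  obtain z where z: "z \<in> Field r" "rk z = 0" "\<forall>x\<in>Field r. (z, x) \<in> r" using bot by blast
  then have "level 0 = {z}" using rk_less by (force simp: level_def)
  then show ?thesis ..
qed

lemma level_n: "\<exists>z. level n = {z}"
proof -
  obtain z where z: "z \<in> Field r" "rk z = n" "\<forall>x\<in>Field r. (x, z) \<in> r" using top by blast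
  then have "level n = {z}" using rk_less by (force simp: level_def)
  then show ?thesis ..
qed

lemma Chains_comparable: "C \<in> Chains r \<Longrightarrow> x \<in> C \<Longrightarrow> y \<in> C \<Longrightarrow> (x, y) \<in> r \<or> (y, x) \<in> r"
  unfolding Chains_def by blast

lemma Chains_rk_le:
  assumes "C \<in> Chains r" "x \<in> C" "y \<in> C" "rk x \<le> rk y"
  shows "(x, y) \<in> r"
  using Chains_comparable[OF assms(1-3)] rk_less[of y x] assms(4) by fastforce

lemma inj_on_rk_Chains: "C \<in> Chains r \<Longrightarrow> inj_on rk C"
  by (rule inj_onI) (metis Chains_rk_le antisym order.refl)

text \<open>Such a chain skips no rank: a skipped rank could be filled by interpolating between its
  neighbours in \<open>C\<close>, and saturation would put the new element into \<open>C\<close>.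
  This serves both maximal chains and longest chains below \<open>t\<close>.\<close>

lemma card_saturated_chain:
  assumes C: "C \<in> Chains r" "t \<in> C" "C \<subseteq> under r t"
    and sat: "\<And>x. (x, t) \<in> r \<Longrightarrow> \<forall>y\<in>C. (x, y) \<in> r \<or> (y, x) \<in> r \<Longrightarrow> x \<in> C"
  shows "card C = rk t + 1"
proof -
  have fin: "finite C" using C(1) Chains_subset_Field finite_Field finite_subset by blast
  have F: "x \<in> Field r" if "x \<in> C" for x using that C(1) Chains_subset_Field by blast
  have "rk ` C = {0..rk t}"
  proof (intro equalityI subsetI)
    fix i assume "i \<in> {0..rk t}"
    then have i: "i \<le> rk t" by simp
    obtain b where b: "b \<in> Field r" "rk b = 0" "\<forall>x\<in>Field r. (b, x) \<in> r" using bot by blast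
    \<comment> \<open>The bottom and \<open>t\<close> provide elements of \<open>C\<close> of rank
      at most and at least \<open>i\<close>, so the neighbours \<open>x\<close> and \<open>y\<close>
      exist.\<close>
    have "b \<in> C" using sat[of b] b F C(2) by blast
    then have X: "finite (rk ` {x\<in>C. rk x \<le> i})" "rk ` {x\<in>C. rk x \<le> i} \<noteq> {}"
      using fin b by auto
    obtain x where x: "x \<in> C" "rk x \<le> i" "\<And>c. c \<in> C \<Longrightarrow> rk c \<le> i \<Longrightarrow> rk c \<le> rk x"
      using Max_in[OF X] Max_ge[OF X(1)] by auto
    have Y: "finite (rk ` {x\<in>C. i \<le> rk x})" "rk ` {x\<in>C. i \<le> rk x} \<noteq> {}"
      using fin C(2) i by auto
    obtain y where y: "y \<in> C" "i \<le> rk y" "\<And>c. c \<in> C \<Longrightarrow> i \<le> rk c \<Longrightarrow> rk y \<le> rk c"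
      using Min_in[OF Y] Min_le[OF Y(1)] by auto
    have "(x, y) \<in> r" using Chains_rk_le[OF C(1) x(1) y(1)] x(2) y(2) by linarith
    then obtain z where z: "(x, z) \<in> r" "(z, y) \<in> r" "rk z = i"
      using interpolate x(2) y(2) by blast
    have "(z, c) \<in> r \<or> (c, z) \<in> r" if c: "c \<in> C" for c
    proof (cases "rk c \<le> i")
      case True
      then have "(c, x) \<in> r" using Chains_rk_le[OF C(1) c x(1)] x(3)[OF c] by blast
      then show ?thesis using z(1) trans by blast
    next
      case False
      then have "(y, c) \<in> r" using Chains_rk_le[OF C(1) y(1) c] y(3)[OF c] by simp
      then show ?thesis using z(2) trans by blast
    qed
    moreover have "(z, t) \<in> r" using z(2) y(1) C(3) trans by (auto simp: under_def)
    ultimately have "z \<in> C" using sat by blast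
    then show "i \<in> rk ` C" using z(3) by blast
  qed (use C(3) rk_le in \<open>auto simp: under_def\<close>)
  then show ?thesis using card_image[OF inj_on_rk_Chains[OF C(1)]] by simp
qed

text \<open>A maximal chain contains the top, so it is a saturated chain below the top.\<close>

lemma graded: "graded_poset n r"
  unfolding graded_poset_def
proof (intro conjI allI impI)
  fix C assume C: "maximal_chain r C"
  obtain u where u: "u \<in> Field r" "rk u = n" "\<forall>x\<in>Field r. (x, u) \<in> r" using top by blast
  have CC: "C \<in> Chains r" and mx: "\<And>D. D \<in> Chains r \<Longrightarrow> C \<subseteq> D \<Longrightarrow> D = C"
    using C by (auto simp: maximal_chain_def)
  have sat: "x \<in> C" if "x \<in> Field r" "\<forall>y\<in>C. (x, y) \<in> r \<or> (y, x) \<in> r" for x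
  proof -
    have "insert x C \<in> Chains r" using CC that refl[of x] by (auto simp: Chains_def)
    then show ?thesis using mx by blast
  qed
  have "C \<subseteq> Field r" using CC Chains_subset_Field by blast
  then have "u \<in> C" "C \<subseteq> under r u" using sat[of u] u by (auto simp: under_def)
  then show "card C = n + 1"
    using card_saturated_chain[OF CC, of u] sat u(2) by (auto intro: FieldI1)
qed (fact finite_Field partial_order)+

text \<open>A longest chain below \<open>t\<close> is saturated. In particular the rank function is
  unique on the elements, which allows ranks to be compared across isomorphisms.\<close>

lemma poset_rank_eq: "t \<in> Field r \<Longrightarrow> poset_rank r t = rk t"
  using longest_chain_below[OF finite_Field partial_order, of t] card_saturated_chain[of _ t]
  by (metis add_right_cancel)

lemma has_bot: "has_bot r" using bot by (auto simp: has_bot_def)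

lemma has_top: "has_top r" using top by (auto simp: has_top_def)

end

text \<open>The converse of \<open>graded\<close>, \<open>has_bot\<close> and
  \<open>has_top\<close>; it brings the given definitions into the locale.\<close>

lemma ranked_poset_poset_rank:
  assumes gr: "graded_poset n r" and "has_bot r" "has_top r"
  shows "ranked_poset r n (poset_rank r)"
proof -
  have fin: "finite (Field r)" and po: "Partial_order r"
    and len: "\<And>C. maximal_chain r C \<Longrightarrow> card C = n + 1"
    using gr by (auto simp: graded_poset_def)
  have tr: "\<And>x y z. (x, y) \<in> r \<Longrightarrow> (y, z) \<in> r \<Longrightarrow> (x, z) \<in> r"
    and an: "\<And>x y. (x, y) \<in> r \<Longrightarrow> (y, x) \<in> r \<Longrightarrow> x = y"
    and rf: "\<And>x. x \<in> Field r \<Longrightarrow> (x, x) \<in> r"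
    using po by (auto simp: partial_order_on_def preorder_on_def refl_on_def dest: transD antisymD)
  have less: "poset_rank r x < poset_rank r y" if "(x, y) \<in> r" "x \<noteq> y" for x y
  proof -
    have xy: "x \<in> Field r" "y \<in> Field r" using that by (auto intro: FieldI1 FieldI2)
    obtain C where C: "C \<in> Chains r" "C \<subseteq> under r x" "card C = poset_rank r x + 1"
      using longest_chain_below[OF fin po xy(1)] by metis
    have finC: "finite C" using C(1) Chains_subset_Field fin finite_subset by blast
    have Cx: "\<And>c. c \<in> C \<Longrightarrow> (c, x) \<in> r" using C(2) by (auto simp: under_def)
    have "y \<notin> C" using Cx that an by blast
    \<comment> \<open>Appending \<open>y\<close> to a longest chain below \<open>x\<close> gives a
      longer chain below \<open>y\<close>.\<close>
    have le: "\<And>c. c \<in> C \<Longrightarrow> (c, y) \<in> r" using Cx that tr by blast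
    then have "insert y C \<in> Chains r" "insert y C \<subseteq> under r y"
      using C(1) rf[OF xy(2)] by (auto simp: Chains_def under_def)
    moreover have "finite {card C - 1 | C. C \<in> Chains r \<and> C \<subseteq> under r y}"
    proof -
      have "{card C - 1 | C. C \<in> Chains r \<and> C \<subseteq> under r y} \<subseteq> (\<lambda>C. card C - 1) ` Chains r" by blast
      then show ?thesis using finite_Chains[OF fin] finite_surj by blast
    qed
    ultimately have "card (insert y C) - 1 \<le> poset_rank r y"
      unfolding poset_rank_def by (intro Max_ge) auto
    then show ?thesis using \<open>y \<notin> C\<close> finC C(3) by simp
  qed
  obtain b where b: "b \<in> Field r" "\<forall>x\<in>Field r. (b, x) \<in> r" using assms(2) by (auto simp: has_bot_def)
  obtain u where u: "u \<in> Field r" "\<forall>x\<in>Field r. (x, u) \<in> r" using assms(3) by (auto simp: has_top_def)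
  have "poset_rank r b = 0"
    by (rule poset_rank_minimal[OF fin po b(1)]) (meson FieldI1 an b(2))
  moreover have "poset_rank r u = n"
  proof -
    obtain C where C: "C \<in> Chains r" "card C = poset_rank r u + 1"
      "\<And>x. (x, u) \<in> r \<Longrightarrow> \<forall>y\<in>C. (x, y) \<in> r \<or> (y, x) \<in> r \<Longrightarrow> x \<in> C"
      using longest_chain_below[OF fin po u(1)] by metis
    \<comment> \<open>Everything lies below \<open>u\<close>, so a longest chain below
      \<open>u\<close> is maximal in the whole poset.\<close>
    have "maximal_chain r C"
      unfolding maximal_chain_def
    proof (intro conjI ballI impI equalityI subsetI)
      fix D x assume D: "D \<in> Chains r" "C \<subseteq> D" "x \<in> D"
      have "x \<in> Field r" using D Chains_subset_Field by blast
      moreover have "\<forall>y\<in>C. (x, y) \<in> r \<or> (y, x) \<in> r" using D unfolding Chains_def by blast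
      ultimately show "x \<in> C" using C(3) u(2) by blast
    qed (use C(1) in auto)
    then show ?thesis using len C(2) by fastforce
  qed
  moreover have "\<exists>z. (x, z) \<in> r \<and> (z, y) \<in> r \<and> poset_rank r z = Suc (poset_rank r x)"
    if xy: "(x, y) \<in> r" "x \<noteq> y" for x y
  proof -
    \<comment> \<open>An element of least rank among those strictly above \<open>x\<close> and at
      most \<open>y\<close> covers \<open>x\<close>, because ranks increase strictly.\<close>
    obtain z where z: "(x, z) \<in> r \<and> (z, y) \<in> r \<and> x \<noteq> z"
      "\<And>c. (x, c) \<in> r \<and> (c, y) \<in> r \<and> x \<noteq> c \<Longrightarrow> poset_rank r z \<le> poset_rank r c"
      using xy rf[of y] FieldI2[OF xy(1)]
        exists_least_iff[of "\<lambda>m. \<exists>c. ((x, c) \<in> r \<and> (c, y) \<in> r \<and> x \<noteq> c) \<and> poset_rank r c = m"]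
      by (metis not_le)
    have "c = x \<or> c = z" if "(x, c) \<in> r" "(c, z) \<in> r" for c
      using z(2)[of c] that tr[OF that(2)] z(1) less[OF that(2)] by fastforce
    then have "poset_rank r z = poset_rank r x + 1"
      using z(1) by (intro poset_rank_cover[OF gr]) auto
    then show ?thesis using z(1) by auto
  qed
  ultimately show ?thesis
    using fin po less b u by unfold_locales blast+
qed

section \<open>Multiplicity-freeness is a bound on the level sizes\<close>

context ranked_poset
begin

text \<open>The negative of the reduced Euler characteristic of the order complex of \<open>A\<close>.\<close>

definition euler :: "'a set \<Rightarrow> int" where
  "euler A = (\<Sum>C\<in>{C \<in> Chains r. C \<subseteq> A}. (-1) ^ card C)"

lemma euler_empty: "euler {} = 1"
proof -
  have "{C \<in> Chains r. C \<subseteq> {}} = {{}}" by (auto simp: Chains_def)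
  then show ?thesis by (simp add: euler_def)
qed

text \<open>Deleting \<open>v\<close> maps the chains through \<open>v\<close> bijectively to the
  chains in the link of \<open>v\<close> and changes their sign.\<close>

lemma euler_remove:
  assumes "v \<in> A" "v \<in> Field r"
  shows "euler A = euler (A - {v}) - euler {x \<in> A - {v}. (x, v) \<in> r \<or> (v, x) \<in> r}"
proof -
  let ?L = "{x \<in> A - {v}. (x, v) \<in> r \<or> (v, x) \<in> r}"
  let ?K = "\<lambda>A. {C \<in> Chains r. C \<subseteq> A}"
  have fin: "finite (?K B)" for B using finite_Chains[OF finite_Field] by simp
  have split: "?K A = ?K (A - {v}) \<union> insert v ` ?K ?L"
  proof (intro equalityI subsetI)
    fix C assume C: "C \<in> ?K A"
    show "C \<in> ?K (A - {v}) \<union> insert v ` ?K ?L"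
    proof (cases "v \<in> C")
      case True
      then have "C - {v} \<in> ?K ?L" using C Chains_comparable[of C v] by (auto simp: Chains_def)
      moreover have "C = insert v (C - {v})" using True by blast
      ultimately show ?thesis by blast
    qed (use C in auto)
  next
    fix C assume "C \<in> ?K (A - {v}) \<union> insert v ` ?K ?L"
    then show "C \<in> ?K A" using assms refl[of v] by (auto simp: Chains_def; blast)
  qed
  have inj: "inj_on (insert v) (?K ?L)" by (rule inj_onI) blast
  have "euler A = euler (A - {v}) + (\<Sum>C\<in>insert v ` ?K ?L. (-1) ^ card C)"
    unfolding euler_def split by (rule sum.union_disjoint) (use fin in auto)
  also have "(\<Sum>C\<in>insert v ` ?K ?L. (-1) ^ card C) = (\<Sum>C\<in>?K ?L. (-1 :: int) ^ card (insert v C))"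
    using sum.reindex[OF inj, of "\<lambda>C. (-1 :: int) ^ card C"] by (simp add: o_def)
  also have "\<dots> = (\<Sum>C\<in>?K ?L. - ((-1) ^ card C))"
  proof (rule sum.cong)
    fix C assume C: "C \<in> ?K ?L"
    then have "finite C" "v \<notin> C"
      using finite_subset[OF Chains_subset_Field finite_Field] by auto
    then show "(-1) ^ card (insert v C) = - ((-1) ^ card C :: int)" by simp
  qed simp
  also have "\<dots> = - euler ?L" by (simp add: euler_def sum_negf)
  finally show ?thesis by simp
qed

text \<open>The link of a cone point is all the rest, so the two terms of
  \<open>euler_remove\<close> cancel.\<close>

lemma euler_cone:
  assumes "v \<in> A" "v \<in> Field r" "\<And>x. x \<in> A \<Longrightarrow> (x, v) \<in> r \<or> (v, x) \<in> r"
  shows "euler A = 0"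
proof -
  have "{x \<in> A - {v}. (x, v) \<in> r \<or> (v, x) \<in> r} = A - {v}" using assms(3) by auto
  then show ?thesis using euler_remove[OF assms(1,2)] by simp
qed

section \<open>Flag h-vectors and Euler characteristics of rank-selected subposets\<close>

definition levels :: "nat set \<Rightarrow> 'a set" where
  "levels S = {x \<in> Field r. rk x \<in> S}"

text \<open>The chains in \<open>levels S\<close> are sorted by their rank set \<open>T\<close>. A
  chain has as many elements as ranks, so the sign for \<open>S - T\<close> splits into a factor for
  \<open>S\<close> and a factor for the chain.\<close>

lemma flag_h_eq_euler:
  assumes "finite S"
  shows "flag_h r S = (-1) ^ card S * euler (levels S)"
proof -
  let ?K = "{C \<in> Chains r. C \<subseteq> levels S}"
  have fin: "finite (Chains r)" using finite_Chains[OF finite_Field] .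
  have rank: "poset_rank r ` C = rk ` C" if "C \<in> Chains r" for C
    using Chains_subset_Field[OF that] poset_rank_eq by (intro image_cong) auto
  have card: "card (rk ` C) = card C" if "C \<in> Chains r" for C
    using card_image[OF inj_on_rk_Chains[OF that]] .
  have K: "?K = {C \<in> Chains r. rk ` C \<in> Pow S}"
    using Chains_subset_Field by (fastforce simp: levels_def)
  have "flag_h r S = (\<Sum>T\<in>Pow S. \<Sum>C\<in>{C\<in>?K. rk ` C = T}. (-1) ^ card S * (-1) ^ card C)"
    unfolding flag_h_def
  proof (rule sum.cong)
    fix T assume T: "T \<in> Pow S"
    then have "card S = card (S - T) + card T"
      using assms by (simp add: card_Diff_subset card_mono finite_subset)
    then have sgn: "(-1) ^ card (S - T) = ((-1) ^ card S * (-1) ^ card T :: int)"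
      by (simp add: power_add)
    have "{C\<in>?K. rk ` C = T} = {C \<in> Chains r. poset_rank r ` C = T}"
      using T unfolding K by (auto simp: rank cong: conj_cong)
    then have "(-1) ^ card (S - T) * int (flag_f r T)
        = (\<Sum>C\<in>{C\<in>?K. rk ` C = T}. (-1) ^ card S * (-1) ^ card T)"
      using sgn by (simp add: flag_f_def)
    also have "\<dots> = (\<Sum>C\<in>{C\<in>?K. rk ` C = T}. (-1) ^ card S * (-1) ^ card C)"
      by (rule sum.cong) (use card in auto)
    finally show "(-1) ^ card (S - T) * int (flag_f r T)
        = (\<Sum>C\<in>{C\<in>?K. rk ` C = T}. (-1) ^ card S * (-1) ^ card C)" .
  qed simp
  also have "\<dots> = (\<Sum>C\<in>?K. (-1) ^ card S * (-1) ^ card C)"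
    by (rule sum.group) (use assms fin K in auto)
  finally show ?thesis by (simp add: euler_def sum_distrib_left)
qed

text \<open>
  If \<open>v\<close> is below just one of the two elements of the lowest level in \<open>S\<close>, that element is a cone
  point of the part above \<open>v\<close>; otherwise \<open>v\<close> is below everything.
\<close>

lemma euler_above:
  assumes v: "v \<in> Field r" and S: "S \<subseteq> {..n}" "\<And>s. s \<in> S \<Longrightarrow> rk v < s"
    and two: "\<And>s. s \<in> S \<Longrightarrow> card (level s) \<le> 2"
  shows "euler {x \<in> levels S. (v, x) \<in> r} \<in> {0, euler (levels S)}"
proof (cases "S = {}")
  case True
  then show ?thesis by (simp add: levels_def)
next
  case False
  define m where "m = (LEAST s. s \<in> S)"
  have m: "m \<in> S" "\<And>s. s \<in> S \<Longrightarrow> m \<le> s"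
    using False LeastI[of "\<lambda>s. s \<in> S"] Least_le[of "\<lambda>s. s \<in> S"] by (auto simp: m_def)
  obtain w where w: "w \<in> level m" "(v, w) \<in> r"
    using ex_above[OF v, of m] m(1) S by force
  show ?thesis
  proof (cases "\<forall>w'\<in>level m. (v, w') \<in> r")
    case True
    have "(v, x) \<in> r" if "x \<in> levels S" for x
      using that ex_below[of x m] m(2) True trans by (auto simp: levels_def)
    then have "{x \<in> levels S. (v, x) \<in> r} = levels S" by blast
    then show ?thesis by simp
  next
    case False
    then obtain w' where w': "w' \<in> level m" "(v, w') \<notin> r" by blast
    then have "w \<noteq> w'" using w(2) by auto
    then have "level m = {w, w'}"
      using card_seteq[OF finite_level, of "{w, w'}" m] w w' two[OF m(1)] by auto
    moreover have "\<exists>z\<in>level m. (v, z) \<in> r \<and> (z, x) \<in> r" if "x \<in> levels S" "(v, x) \<in> r" for x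
      using interpolate[of v x m] that S(2)[OF m(1)] m(2)
      by (fastforce simp: levels_def level_def intro: FieldI1)
    ultimately have "(w, x) \<in> r" if "x \<in> levels S" "(v, x) \<in> r" for x
      using that w'(2) by (metis empty_iff insert_iff)
    then have "euler {x \<in> levels S. (v, x) \<in> r} = 0"
      using w m(1) by (intro euler_cone[of w]) (auto simp: levels_def level_def)
    then show ?thesis by simp
  qed
qed

text \<open>Induction that removes the lowest level of \<open>S\<close>. A single element there is a
  cone point; two elements are removed one after the other by \<open>euler_remove\<close>.\<close>

lemma euler_levels:
  assumes "finite S" "S \<subseteq> {..n}" "\<And>s. s \<in> S \<Longrightarrow> card (level s) \<le> 2"
  shows "euler (levels S) \<in> {0, 1, -1}"
  using assms
proof (induction "card S" arbitrary: S)
  case 0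
  then show ?case by (simp add: levels_def euler_empty)
next
  case (Suc k)
  define m where "m = (LEAST s. s \<in> S)"
  have "S \<noteq> {}" using Suc.hyps(2) by auto
  then have m: "m \<in> S" "\<And>s. s \<in> S \<Longrightarrow> m \<le> s"
    using LeastI[of "\<lambda>s. s \<in> S"] Least_le[of "\<lambda>s. s \<in> S"] by (auto simp: m_def)
  define S' where "S' = S - {m}"
  have S': "s \<in> S' \<Longrightarrow> m < s" for s using m(2) by (auto simp: S'_def order.strict_iff_order)
  have IH: "euler (levels S') \<in> {0, 1, -1}"
    using Suc.hyps(2) Suc.prems m(1) by (intro Suc.hyps(1)) (auto simp: S'_def)
  have lev: "levels S = level m \<union> levels S'" using m(1) by (auto simp: levels_def level_def S'_def)
  have above: "euler {x \<in> levels S'. (v, x) \<in> r} \<in> {0, euler (levels S')}" if "v \<in> level m" for v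
    using that Suc.prems S' by (intro euler_above) (auto simp: level_def S'_def)
  have "level m \<noteq> {}" using level_eq_empty_iff m(1) Suc.prems(2) by force
  then have "card (level m) = 1 \<or> card (level m) = 2"
    using Suc.prems(3)[OF m(1)] finite_level[of m] card_gt_0_iff[of "level m"] by linarith
  then consider v where "level m = {v}" | v w where "level m = {v, w}" "v \<noteq> w"
    by (auto simp: card_1_singleton_iff card_2_iff)
  then show ?case
  proof cases
    case 1
    have "(v, x) \<in> r" if "x \<in> levels S" for x
      using that 1 ex_below[of x m] m(2) by (auto simp: levels_def)
    then have "euler (levels S) = 0"
      using 1 lev by (intro euler_cone[of v]) (auto simp: levels_def level_def)
    then show ?thesis by simp
  next
    case 2
    have F: "v \<in> Field r" "w \<in> Field r" and rk: "rk v = m" "rk w = m"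
      using 2 by (auto simp: level_def)
    have S'rk: "m < rk x" if "x \<in> levels S'" for x using that S' by (auto simp: levels_def)
    have vw: "(v, w) \<notin> r" "(w, v) \<notin> r" using rk_less[of v w] rk_less[of w v] rk 2(2) by auto
    have notin: "v \<notin> levels S'" "w \<notin> levels S'" using S'rk[of v] S'rk[of w] rk by auto
    have nle: "(x, v) \<notin> r" "(x, w) \<notin> r" if "x \<in> levels S'" for x
      using rk_le[of x v] rk_le[of x w] rk S'rk[OF that] by auto
    \<comment> \<open>The link of \<open>v\<close>, and then that of \<open>w\<close>, is just the
      part of \<open>levels S'\<close> above it: \<open>v\<close> and \<open>w\<close> are
      incomparable, and nothing in \<open>levels S'\<close> lies below them.\<close>
    have "levels S - {v} = insert w (levels S')" using lev 2 notin by auto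
    moreover have "{x \<in> levels S - {v}. (x, v) \<in> r \<or> (v, x) \<in> r} = {x \<in> levels S'. (v, x) \<in> r}"
      using lev 2 vw nle notin by auto
    ultimately have "euler (levels S)
        = euler (insert w (levels S')) - euler {x \<in> levels S'. (v, x) \<in> r}"
      using euler_remove[of v "levels S"] lev 2 F by auto
    moreover have "{x \<in> insert w (levels S') - {w}. (x, w) \<in> r \<or> (w, x) \<in> r}
        = {x \<in> levels S'. (w, x) \<in> r}"
      using vw nle notin by auto
    then have "euler (insert w (levels S'))
        = euler (levels S') - euler {x \<in> levels S'. (w, x) \<in> r}"
      using euler_remove[of w "insert w (levels S')"] F notin by auto
    \<comment> \<open>Both subtracted terms are 0 or \<open>euler (levels S')\<close>, so the result
      is 1, 0 or -1 times \<open>euler (levels S')\<close>.\<close>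
    ultimately show ?thesis using above[of v] above[of w] 2 IH by auto
  qed
qed

text \<open>The only chains inside one level are the empty chain and the singletons. This makes
  \<open>flag_h\<close> at \<open>{i}\<close> a measure of the size of level
  \<open>i\<close>.\<close>

lemma euler_level: "euler (levels {i}) = 1 - int (card (level i))"
proof -
  have K: "{C \<in> Chains r. C \<subseteq> levels {i}} = insert {} ((\<lambda>x. {x}) ` level i)" (is "?K = ?R")
  proof (intro equalityI subsetI)
    fix C assume C: "C \<in> ?K"
    then have "x = y" if "x \<in> C" "y \<in> C" for x y
      using that inj_on_rk_Chains[of C] by (auto simp: levels_def inj_on_def)
    then have "C = {} \<or> (\<exists>x. C = {x})" by blast
    then show "C \<in> ?R" using C by (auto simp: levels_def level_def)
  qed (auto simp: Chains_def levels_def level_def refl)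
  have "euler (levels {i}) = 1 + (\<Sum>C\<in>(\<lambda>x. {x}) ` level i. (-1) ^ card C)"
    unfolding euler_def K using finite_level by (subst sum.insert) auto
  also have "(\<Sum>C\<in>(\<lambda>x. {x}) ` level i. (-1) ^ card C) = (\<Sum>x\<in>level i. - 1 :: int)"
    by (subst sum.reindex) (auto simp: inj_on_def)
  finally show ?thesis by simp
qed

lemma multiplicity_free_iff:
  "flag_h_multiplicity_free n r \<longleftrightarrow> (\<forall>i. card (level i) \<le> 2)"
proof
  assume mf: "flag_h_multiplicity_free n r"
  show "\<forall>i. card (level i) \<le> 2"
  proof
    fix i
    \<comment> \<open>The hypothesis speaks of ranks strictly between 0 and \<open>n\<close>; levels
      0 and \<open>n\<close> are singletons, and higher levels are empty.\<close>
    consider "i = 0" | "i = n" | "n < i" | "0 < i" "i < n" by linarith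
    then show "card (level i) \<le> 2"
    proof cases
      case 4
      then have "flag_h r {i} \<in> {0, 1, -1}" using mf by (auto simp: flag_h_multiplicity_free_def)
      then show ?thesis using flag_h_eq_euler[of "{i}"] euler_level[of i] by auto
    qed (use level_0 level_n level_eq_empty_iff[of i] in auto)
  qed
next
  assume two: "\<forall>i. card (level i) \<le> 2"
  show "flag_h_multiplicity_free n r"
    unfolding flag_h_multiplicity_free_def
  proof (intro allI impI)
    fix S assume S: "S \<subseteq> {1..<n}"
    then have "finite S" using finite_subset by blast
    then have "euler (levels S) \<in> {0, 1, -1}" using S two by (intro euler_levels) auto
    moreover have "(-1) ^ card S = (1::int) \<or> (-1) ^ card S = (-1::int)"
      by (cases "even (card S)") auto
    ultimately show "flag_h r S \<in> {0, 1, -1}" using flag_h_eq_euler[OF \<open>finite S\<close>] by auto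
  qed
qed

end

section \<open>Isomorphisms\<close>

lemma poset_iso_sym:
  assumes "poset_iso r s"
  shows "poset_iso s r"
proof -
  obtain f where f: "bij_betw f (Field r) (Field s)"
    "\<And>x y. x \<in> Field r \<Longrightarrow> y \<in> Field r \<Longrightarrow> (x, y) \<in> r \<longleftrightarrow> (f x, f y) \<in> s"
    using assms unfolding poset_iso_def by blast
  let ?g = "inv_into (Field r) f"
  have "bij_betw ?g (Field s) (Field r)" using f(1) by (rule bij_betw_inv_into)
  moreover have "(x, y) \<in> s \<longleftrightarrow> (?g x, ?g y) \<in> r" if "x \<in> Field s" "y \<in> Field s" for x y
    using that f(2)[of "?g x" "?g y"] f(1) by (auto simp: bij_betw_def inv_into_into f_inv_into_f)
  ultimately show ?thesis unfolding poset_iso_def by blast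
qed

lemma poset_iso_trans:
  assumes "poset_iso r s" "poset_iso s t"
  shows "poset_iso r t"
proof -
  obtain f g where f: "bij_betw f (Field r) (Field s)"
    "\<forall>x \<in> Field r. \<forall>y \<in> Field r. (x, y) \<in> r \<longleftrightarrow> (f x, f y) \<in> s"
    and g: "bij_betw g (Field s) (Field t)"
    "\<forall>x \<in> Field s. \<forall>y \<in> Field s. (x, y) \<in> s \<longleftrightarrow> (g x, g y) \<in> t"
    using assms unfolding poset_iso_def by blast
  have "bij_betw (g \<circ> f) (Field r) (Field t)" using f(1) g(1) by (rule bij_betw_trans)
  moreover have "\<forall>x \<in> Field r. \<forall>y \<in> Field r. (x, y) \<in> r \<longleftrightarrow> ((g \<circ> f) x, (g \<circ> f) y) \<in> t"
    using f(2) g(2) bij_betwE[OF f(1)] by simp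
  ultimately show ?thesis unfolding poset_iso_def by blast
qed

text \<open>Transport of structure, for the invariance of \<open>narrow\<close> and for comparing
  ranks across an isomorphism.\<close>

lemma ranked_poset_pullback:
  assumes "ranked_poset r n rk"
    and f: "bij_betw f (Field s) (Field r)"
    and iso: "\<And>x y. x \<in> Field s \<Longrightarrow> y \<in> Field s \<Longrightarrow> (x, y) \<in> s \<longleftrightarrow> (f x, f y) \<in> r"
  shows "ranked_poset s n (rk \<circ> f)"
proof -
  interpret ranked_poset r n rk by fact
  have fF: "\<And>x. x \<in> Field s \<Longrightarrow> f x \<in> Field r" using f by (auto simp: bij_betw_def)
  have inj: "\<And>x y. x \<in> Field s \<Longrightarrow> y \<in> Field s \<Longrightarrow> f x = f y \<Longrightarrow> x = y"
    using f by (auto simp: bij_betw_def inj_on_def)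
  have pre: "\<exists>x\<in>Field s. f x = z" if "z \<in> Field r" for z
    using that f by (metis bij_betw_imp_surj_on imageE)
  have mem: "(x, y) \<in> s \<Longrightarrow> x \<in> Field s \<and> y \<in> Field s \<and> (f x, f y) \<in> r" for x y
    using iso by (meson FieldI1 FieldI2)
  show ?thesis
  proof
    show "finite (Field s)" using f finite_Field bij_betw_finite by blast
    have "refl_on (Field s) s" using iso fF refl by (auto simp: refl_on_def)
    moreover have "Relation.trans s"
      by (rule transI) (meson mem iso trans)
    moreover have "Relation.antisym s"
      by (rule antisymI) (meson mem inj antisym)
    moreover have "s \<subseteq> Field s \<times> Field s" using mem by auto
    ultimately show "Partial_order s" by (simp add: partial_order_on_def preorder_on_def)
    show "\<exists>z\<in>Field s. (rk \<circ> f) z = 0 \<and> (\<forall>x\<in>Field s. (z, x) \<in> s)"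
      using bot pre iso fF by (metis comp_apply)
    show "\<exists>z\<in>Field s. (rk \<circ> f) z = n \<and> (\<forall>x\<in>Field s. (x, z) \<in> s)"
      using top pre iso fF by (metis comp_apply)
    show "(rk \<circ> f) x < (rk \<circ> f) y" if "(x, y) \<in> s" "x \<noteq> y" for x y
      using that mem inj rk_less[of "f x" "f y"] by auto
    show "\<exists>z. (x, z) \<in> s \<and> (z, y) \<in> s \<and> (rk \<circ> f) z = Suc ((rk \<circ> f) x)"
      if xy: "(x, y) \<in> s" "x \<noteq> y" for x y
    proof -
      have "(f x, f y) \<in> r" "f x \<noteq> f y" using mem[OF xy(1)] inj xy(2) by auto
      then obtain z where z: "(f x, z) \<in> r" "(z, f y) \<in> r" "rk z = Suc (rk (f x))"
        using ex_cover by blast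
      then obtain z' where "z' \<in> Field s" "f z' = z" using pre FieldI1[OF z(2)] by blast
      then show ?thesis using z iso mem[OF xy(1)] by (intro exI[of _ z']) auto
    qed
  qed
qed

text \<open>Related elements are joined by steps of rank difference 1, so it is enough to preserve
  those; induction on the rank difference.\<close>

lemma ranked_poset_cover_hom:
  assumes "ranked_poset r n rk" "ranked_poset s m rk'"
    and f: "\<And>x. x \<in> Field r \<Longrightarrow> f x \<in> Field s"
    and cov: "\<And>x y. (x, y) \<in> r \<Longrightarrow> rk y = Suc (rk x) \<Longrightarrow> (f x, f y) \<in> s"
    and xy: "(x, y) \<in> r"
  shows "(f x, f y) \<in> s"
  using xy
proof (induction "rk y - rk x" arbitrary: x rule: less_induct)
  case less
  interpret r: ranked_poset r n rk by fact
  interpret s: ranked_poset s m rk' by fact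
  show ?case
  proof (cases "x = y")
    case True
    then show ?thesis using s.refl f FieldI1[OF less.prems] by blast
  next
    case False
    then obtain z where z: "(x, z) \<in> r" "(z, y) \<in> r" "rk z = Suc (rk x)"
      using r.ex_cover less.prems by blast
    have "rk y - rk z < rk y - rk x" using z r.rk_le[OF z(2)] by simp
    then have "(f z, f y) \<in> s" using less.hyps z(2) by blast
    then show ?thesis using cov[OF z(1,3)] s.trans by blast
  qed
qed

text \<open>The relations between adjacent levels generate the order:
  \<open>ranked_poset_cover_hom\<close> applies to \<open>f\<close> and to its inverse.\<close>

lemma poset_iso_by_covers:
  assumes r: "ranked_poset r n rk" and s: "ranked_poset s m rk'"
    and f: "bij_betw f (Field r) (Field s)"
    and rk: "\<And>x. x \<in> Field r \<Longrightarrow> rk' (f x) = rk x"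
    and cov: "\<And>x y. x \<in> Field r \<Longrightarrow> y \<in> Field r \<Longrightarrow> rk y = Suc (rk x) \<Longrightarrow>
      (x, y) \<in> r \<longleftrightarrow> (f x, f y) \<in> s"
  shows "poset_iso r s"
proof -
  let ?g = "inv_into (Field r) f"
  have g: "?g z \<in> Field r" "f (?g z) = z" if "z \<in> Field s" for z
    using that f by (auto simp: bij_betw_def inv_into_into f_inv_into_f)
  have gf: "?g (f x) = x" if "x \<in> Field r" for x
    using that f by (auto simp: bij_betw_def)
  have ff: "f x \<in> Field s" if "x \<in> Field r" for x using that f by (auto simp: bij_betw_def)
  have "(f x, f y) \<in> s" if "(x, y) \<in> r" for x y
    using that
  proof (rule ranked_poset_cover_hom[OF r s ff, rotated -1])
    fix x y assume "(x, y) \<in> r" "rk y = Suc (rk x)"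
    then show "(f x, f y) \<in> s" using cov by (meson FieldI1 FieldI2)
  qed
  moreover have "(?g x, ?g y) \<in> r" if "(x, y) \<in> s" for x y
    using that
  proof (rule ranked_poset_cover_hom[OF s r g(1), rotated -1])
    fix x y assume xy: "(x, y) \<in> s" "rk' y = Suc (rk' x)"
    then have "x \<in> Field s" "y \<in> Field s" by (auto intro: FieldI1 FieldI2)
    then show "(?g x, ?g y) \<in> r"
      using xy g cov[of "?g x" "?g y"] rk[of "?g x"] rk[of "?g y"] by simp
  qed
  ultimately have "\<forall>x\<in>Field r. \<forall>y\<in>Field r. (x, y) \<in> r \<longleftrightarrow> (f x, f y) \<in> s"
    using gf by metis
  then show ?thesis unfolding poset_iso_def using f by blast
qed

text \<open>The rank function is quantified away to get a property of the relation alone; on the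
  elements it can only be \<open>poset_rank r\<close>.\<close>

definition narrow :: "nat \<Rightarrow> 'a rel \<Rightarrow> bool" where
  "narrow n r \<longleftrightarrow> (\<exists>rk. ranked_poset r n rk \<and> (\<forall>i. card (ranked_poset.level r rk i) \<le> 2))"

lemma narrow_iso:
  assumes "narrow n r" "poset_iso s r"
  shows "narrow n s"
proof -
  obtain rk where rk: "ranked_poset r n rk" "\<And>i. card (ranked_poset.level r rk i) \<le> 2"
    using assms(1) by (auto simp: narrow_def)
  obtain f where f: "bij_betw f (Field s) (Field r)"
    "\<And>x y. x \<in> Field s \<Longrightarrow> y \<in> Field s \<Longrightarrow> (x, y) \<in> s \<longleftrightarrow> (f x, f y) \<in> r"
    using assms(2) by (auto simp: poset_iso_def)
  interpret r: ranked_poset r n rk by fact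
  interpret s: ranked_poset s n "rk \<circ> f" by (rule ranked_poset_pullback[OF rk(1) f])
  have "card (s.level i) \<le> 2" for i
  proof -
    have "inj_on f (s.level i)" "f ` s.level i \<subseteq> r.level i"
      using f(1) by (auto simp: bij_betw_def inj_on_def s.level_def r.level_def)
    then have "card (s.level i) \<le> card (r.level i)"
      using card_inj_on_le r.finite_level by blast
    then show ?thesis using rk(2)[of i] by simp
  qed
  then show ?thesis using s.ranked_poset_axioms by (auto simp: narrow_def)
qed

text \<open>Here flag vectors leave the proof: \<open>multiplicity_free_iff\<close> turns them into
  a condition on level sizes.\<close>

lemma mf_posets_eq: "mf_posets n k = {r. Field r = {..<k} \<and> narrow n r}"
proof -
  have "graded_poset n r \<and> has_bot r \<and> has_top r \<and> flag_h_multiplicity_free n r \<longleftrightarrow> narrow n r"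
    for r :: "'b rel"
    using ranked_poset_poset_rank[of n r] ranked_poset.multiplicity_free_iff[of r n]
      ranked_poset.graded[of r n] ranked_poset.has_bot[of r n] ranked_poset.has_top[of r n]
    unfolding narrow_def by metis
  then show ?thesis by (auto simp: mf_posets_def)
qed

section \<open>Codes for narrow posets\<close>

text \<open>
  A letter describes a level and its relation to the level below: \<open>One\<close> is a level with a single
  element, the other letters stand for two elements, labelled by truth values, which are related to
  the level below completely (\<open>Full\<close>), by a matching, or by all pairs but one (\<open>Up\<close>, \<open>Down\<close>).
  Swapping both labels of a level, back to the last \<open>One\<close> or \<open>Full\<close>, does not change the isomorphism
  type. In a normal form, this freedom is used to make the first letter after that which is not a
  matching an \<open>Up\<close>; matchings are written \<open>MatchS\<close> before this happens and \<open>MatchB\<close> after.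
\<close>

datatype letter = One | Full | MatchS | MatchB | Up | Down

lemma UNIV_letter: "UNIV = {One, Full, MatchS, MatchB, Up, Down}"
  using letter.exhaust by auto

text \<open>The first label belongs to the lower level. \<open>Up\<close> omits only the pair
  \<open>(True, False)\<close>, and \<open>Down\<close> only \<open>(False, True)\<close>.\<close>

fun edge :: "letter \<Rightarrow> bool \<Rightarrow> bool \<Rightarrow> bool" where
  "edge One a b = True"
| "edge Full a b = True"
| "edge MatchS a b = (a = b)"
| "edge MatchB a b = (a = b)"
| "edge Up a b = (a \<longrightarrow> b)"
| "edge Down a b = (b \<longrightarrow> a)"

definition labels :: "letter \<Rightarrow> bool set" where
  "labels c = (if c = One then {False} else UNIV)"

definition symmetric :: "letter \<Rightarrow> bool" where
  "symmetric c \<longleftrightarrow> c = Full \<or> c = MatchS"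

definition broken :: "letter \<Rightarrow> bool" where
  "broken c \<longleftrightarrow> c = MatchB \<or> c = Up \<or> c = Down"

text \<open>The letter just read serves as the state. After \<open>One\<close>, a level of two
  elements can only be \<open>Full\<close>. After a symmetric letter \<open>Down\<close> is
  excluded, since swapping the labels of both levels turns it into \<open>Up\<close>. After a broken
  letter the labels are fixed, so \<open>Up\<close> and \<open>Down\<close> both occur.\<close>

fun ok :: "letter \<Rightarrow> letter \<Rightarrow> bool" where
  "ok d One = True"
| "ok d Full = True"
| "ok d MatchS = symmetric d"
| "ok d MatchB = broken d"
| "ok d Up = (d \<noteq> One)"
| "ok d Down = broken d"

definition code :: "letter list \<Rightarrow> bool" where
  "code w \<longleftrightarrow> w \<noteq> [] \<and> w ! 0 = One \<and> (\<forall>i. Suc i < length w \<longrightarrow> ok (w ! i) (w ! Suc i))"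

lemma last_eq_nth: "length w = Suc i \<Longrightarrow> last w = w ! i"
  by (cases w rule: rev_cases) auto

lemma code_append: "w \<noteq> [] \<Longrightarrow> code (w @ [c]) \<longleftrightarrow> code w \<and> ok (last w) c"
proof -
  assume w: "w \<noteq> []"
  then have "(\<forall>i. Suc i < length (w @ [c]) \<longrightarrow> ok ((w @ [c]) ! i) ((w @ [c]) ! Suc i)) \<longleftrightarrow>
      (\<forall>i. Suc i < length w \<longrightarrow> ok (w ! i) (w ! Suc i)) \<and> ok (w ! (length w - 1)) c"
    (is "(\<forall>i. ?P i) \<longleftrightarrow> (\<forall>i. ?Q i) \<and> ?R")
  proof -
    have "?P i \<longleftrightarrow> ?Q i \<and> (Suc i = length w \<longrightarrow> ?R)" for i
      by (cases "Suc i = length w") (auto simp: nth_append dest: sym)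
    moreover have "Suc (length w - 1) = length w" using w by simp
    ultimately show ?thesis by metis
  qed
  then show ?thesis using w by (simp add: code_def nth_append last_conv_nth)
qed

text \<open>The flags \<open>s\<close> and \<open>t\<close> record whether two labellings differ by
  a swap on the lower and on the upper level. As no swap is possible above a broken letter, a finite
  check settles the claim.\<close>

lemma normal_form_unique:
  assumes "\<And>a b. edge c a b \<longleftrightarrow> edge c' (a \<noteq> s) (b \<noteq> t)"
    and "ok d c" "ok d c'" "c \<noteq> One" "c' \<noteq> One" "broken d \<longrightarrow> \<not> s"
  shows "c = c' \<and> (broken c \<longrightarrow> \<not> t)"
  using assms(2-) assms(1)[of True True] assms(1)[of True False]
    assms(1)[of False True] assms(1)[of False False]
  by (cases c; cases c'; cases s; cases t) (auto simp: symmetric_def broken_def)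

text \<open>This reads a letter off the relation \<open>E\<close> between two levels of size two, up
  to swaps. The last clause lets a swap below compensate any swap \<open>t\<close> above; the
  induction in \<open>labelling_exists\<close> needs it to pass the symmetry on.\<close>

lemma normal_form_exists:
  fixes E :: "bool \<Rightarrow> bool \<Rightarrow> bool"
  assumes "\<And>a. \<exists>b. E a b" "\<And>b. \<exists>a. E a b" "d \<noteq> One"
  shows "\<exists>c. c \<noteq> One \<and> ok d c \<and>
    (\<exists>s t. (broken d \<longrightarrow> \<not> s) \<and> (\<forall>a b. E a b \<longleftrightarrow> edge c (a \<noteq> s) (b \<noteq> t))) \<and>
    (symmetric c \<longrightarrow> (\<forall>t. \<exists>s. (broken d \<longrightarrow> \<not> s) \<and> (\<forall>a b. E a b \<longleftrightarrow> edge c (a \<noteq> s) (b \<noteq> t))))"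
proof -
  have ex: "\<exists>b. E True b" "\<exists>b. E False b" "\<exists>a. E a True" "\<exists>a. E a False" using assms by auto
  let ?w = "\<lambda>c. c \<noteq> One \<and> ok d c \<and>
    (\<exists>s t. (broken d \<longrightarrow> \<not> s) \<and> (\<forall>a b. E a b \<longleftrightarrow> edge c (a \<noteq> s) (b \<noteq> t))) \<and>
    (symmetric c \<longrightarrow> (\<forall>t. \<exists>s. (broken d \<longrightarrow> \<not> s) \<and> (\<forall>a b. E a b \<longleftrightarrow> edge c (a \<noteq> s) (b \<noteq> t))))"
  \<comment> \<open>Seven relations \<open>E\<close> are possible: the complete one, four that omit
    one pair, and two matchings.\<close>
  have "?w Full \<or> ?w MatchS \<or> ?w MatchB \<or> ?w Up \<or> ?w Down"
    using ex assms(3)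
    by (cases "E True True"; cases "E True False"; cases "E False True"; cases "E False False"; cases d)
      (simp_all add: ex_bool_eq all_bool_eq symmetric_def broken_def)
  then show ?thesis by blast
qed

section \<open>The poset described by a word\<close>

definition code_carrier :: "letter list \<Rightarrow> (nat \<times> bool) set" where
  "code_carrier w = {(i, a). i < length w \<and> a \<in> labels (w ! i)}"

definition code_cover :: "letter list \<Rightarrow> (nat \<times> bool) rel" where
  "code_cover w = {(p, q). p \<in> code_carrier w \<and> q \<in> code_carrier w \<and> fst q = Suc (fst p) \<and>
     edge (w ! fst q) (snd p) (snd q)}"

text \<open>The intersection discards the reflexive pairs of the closure that lie outside the
  carrier.\<close>

definition code_poset :: "letter list \<Rightarrow> (nat \<times> bool) rel" where
  "code_poset w = (code_cover w)\<^sup>* \<inter> code_carrier w \<times> code_carrier w"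

lemma Field_code_poset: "Field (code_poset w) = code_carrier w"
  by (auto simp: code_poset_def Field_def)

lemma code_cover_rtrancl_less:
  assumes "(p, q) \<in> (code_cover w)\<^sup>*" "p \<noteq> q"
  shows "fst p < fst q"
proof -
  have "p = q \<or> fst p < fst q" using assms(1)
    by (induction rule: rtrancl_induct) (auto simp: code_cover_def)
  then show ?thesis using assms(2) by blast
qed

text \<open>Each generating pair raises the first component by one, so the closure adds nothing
  between adjacent levels.\<close>

lemma code_poset_step:
  assumes "p \<in> code_carrier w" "q \<in> code_carrier w" "fst q = Suc (fst p)"
  shows "(p, q) \<in> code_poset w \<longleftrightarrow> edge (w ! fst q) (snd p) (snd q)"
proof
  assume "(p, q) \<in> code_poset w"
  then have pq: "(p, q) \<in> (code_cover w)\<^sup>*" by (simp add: code_poset_def)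
  have "p \<noteq> q" using assms(3) by auto
  with pq obtain z where z: "(p, z) \<in> code_cover w" "(z, q) \<in> (code_cover w)\<^sup>*"
    by (metis converse_rtranclE)
  then have "fst z = fst q" using assms(3) by (auto simp: code_cover_def)
  then have "z = q" using code_cover_rtrancl_less[OF z(2)] by auto
  then show "edge (w ! fst q) (snd p) (snd q)" using z(1) by (auto simp: code_cover_def)
next
  assume "edge (w ! fst q) (snd p) (snd q)"
  then have "(p, q) \<in> code_cover w" using assms by (auto simp: code_cover_def)
  then show "(p, q) \<in> code_poset w" using assms by (auto simp: code_poset_def)
qed

text \<open>Together with \<open>ok_labels_above\<close>, this puts every element of a code poset on
  a path from bottom to top.\<close>

lemma ok_labels_below: "ok d c \<Longrightarrow> b \<in> labels c \<Longrightarrow> \<exists>a\<in>labels d. edge c a b"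
  by (cases c; cases b; cases d) (auto simp: labels_def symmetric_def broken_def)

lemma ok_labels_above: "ok d c \<Longrightarrow> a \<in> labels d \<Longrightarrow> \<exists>b\<in>labels c. edge c a b"
  by (cases c; cases a; cases d) (auto simp: labels_def symmetric_def broken_def)

lemma finite_code_carrier: "finite (code_carrier w)"
  by (rule finite_subset[of _ "{..<length w} \<times> UNIV"]) (auto simp: code_carrier_def)

text \<open>The initial \<open>One\<close> gives the bottom and the final \<open>One\<close> the
  top; paths to them are built level by level. Covers are first steps of paths in the
  closure.\<close>

lemma ranked_code_poset:
  assumes w: "code w" "length w = Suc n" "last w = One"
  shows "ranked_poset (code_poset w) n fst"
proof
  let ?r = "code_poset w"
  have ok: "ok (w ! i) (w ! Suc i)" if "i < n" for i using w that by (auto simp: code_def)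
  have w0: "w ! 0 = One" using w by (auto simp: code_def)
  have wn: "w ! n = One" using w(3) last_eq_nth[OF w(2)] by simp
  show "finite (Field ?r)" by (simp add: Field_code_poset finite_code_carrier)
  have "antisym ?r"
  proof (rule antisymI)
    fix p q assume "(p, q) \<in> ?r" "(q, p) \<in> ?r"
    then show "p = q"
      using code_cover_rtrancl_less[of p q w] code_cover_rtrancl_less[of q p w]
      unfolding code_poset_def by (metis IntD1 order.asym)
  qed
  moreover have "trans ?r" by (rule transI) (auto simp: code_poset_def)
  moreover have "refl_on (code_carrier w) ?r" by (auto simp: refl_on_def code_poset_def)
  moreover have "?r \<subseteq> code_carrier w \<times> code_carrier w" by (auto simp: code_poset_def)
  ultimately show "Partial_order ?r"
    by (simp add: partial_order_on_def preorder_on_def Field_code_poset)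
  have bot: "((0, False), (i, a)) \<in> (code_cover w)\<^sup>*" if "(i, a) \<in> code_carrier w" for i a
    using that
  proof (induction i arbitrary: a)
    case 0
    then show ?case using w0 by (auto simp: code_carrier_def labels_def)
  next
    case (Suc i)
    then have "i < n" "a \<in> labels (w ! Suc i)" using w by (auto simp: code_carrier_def)
    then obtain b where b: "b \<in> labels (w ! i)" "edge (w ! Suc i) b a"
      using ok_labels_below ok by blast
    then have "(i, b) \<in> code_carrier w" using \<open>i < n\<close> w by (auto simp: code_carrier_def)
    then have "((0, False), (i, b)) \<in> (code_cover w)\<^sup>*" "((i, b), (Suc i, a)) \<in> code_cover w"
      using Suc b by (auto simp: code_cover_def)
    then show ?case by simp
  qed
  have "(0, False) \<in> code_carrier w" using w0 w(2) by (auto simp: code_carrier_def labels_def)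
  then show "\<exists>z\<in>Field ?r. fst z = 0 \<and> (\<forall>x\<in>Field ?r. (z, x) \<in> ?r)"
    using bot by (intro bexI[of _ "(0, False)"]) (auto simp: Field_code_poset, auto simp: code_poset_def)
  have top: "((i, a), (n, False)) \<in> (code_cover w)\<^sup>*" if "(i, a) \<in> code_carrier w" for i a
    using that
  proof (induction "n - i" arbitrary: i a)
    case 0
    then show ?case using wn w(2) by (auto simp: code_carrier_def labels_def less_Suc_eq)
  next
    case (Suc m)
    then have "i < n" "a \<in> labels (w ! i)" by (auto simp: code_carrier_def)
    then obtain b where b: "b \<in> labels (w ! Suc i)" "edge (w ! Suc i) a b"
      using ok_labels_above ok by blast
    then have "(Suc i, b) \<in> code_carrier w" using \<open>i < n\<close> w by (auto simp: code_carrier_def)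
    then have "((Suc i, b), (n, False)) \<in> (code_cover w)\<^sup>*" "((i, a), (Suc i, b)) \<in> code_cover w"
      using Suc.hyps(1)[of "Suc i" b] Suc.hyps(2) Suc.prems b by (auto simp: code_cover_def)
    then show ?case by (metis converse_rtrancl_into_rtrancl)
  qed
  have "(n, False) \<in> code_carrier w" using wn w(2) by (auto simp: code_carrier_def labels_def)
  then show "\<exists>z\<in>Field ?r. fst z = n \<and> (\<forall>x\<in>Field ?r. (x, z) \<in> ?r)"
    using top by (intro bexI[of _ "(n, False)"]) (auto simp: Field_code_poset, auto simp: code_poset_def)
  show "fst p < fst q" if "(p, q) \<in> ?r" "p \<noteq> q" for p q
    using that code_cover_rtrancl_less[of p q w] by (auto simp: code_poset_def)
  show "\<exists>z. (p, z) \<in> ?r \<and> (z, q) \<in> ?r \<and> fst z = Suc (fst p)" if pq: "(p, q) \<in> ?r" "p \<noteq> q" for p q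
  proof -
    have "(p, q) \<in> (code_cover w)\<^sup>*" using pq by (auto simp: code_poset_def)
    then obtain z where z: "(p, z) \<in> code_cover w" "(z, q) \<in> (code_cover w)\<^sup>*"
      using pq(2) by (metis converse_rtranclE)
    then show ?thesis using pq by (intro exI[of _ z]) (auto simp: code_poset_def code_cover_def)
  qed
qed

text \<open>Two bijections onto \<open>bool\<close> differ by a permutation of \<open>bool\<close>,
  that is, by exclusive or with a constant. Swaps are written in this form everywhere.\<close>

lemma bij_bool_swap:
  assumes l: "bij_betw l A (UNIV :: bool set)" and l': "bij_betw l' A (UNIV :: bool set)"
  shows "\<exists>s. \<forall>x\<in>A. l' x \<longleftrightarrow> l x \<noteq> s"
proof -
  have "True \<in> l ` A" "False \<in> l ` A" using l by (auto simp: bij_betw_def)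
  then obtain a b where ab: "a \<in> A" "b \<in> A" "l a" "\<not> l b" by blast
  have inj: "x = y" if "x \<in> A" "y \<in> A" "l x = l y \<or> l' x = l' y" for x y
    using that l l' by (auto simp: bij_betw_def inj_on_def)
  have "x = a \<or> x = b" if "x \<in> A" for x
    using inj[OF that ab(1)] inj[OF that ab(2)] ab by blast
  moreover have "l' a \<noteq> l' b" using inj[OF ab(1,2)] ab by blast
  ultimately show ?thesis using ab by (intro exI[of _ "l' b"]) auto
qed

section \<open>Reading words off posets by labelling the levels\<close>

context ranked_poset
begin

text \<open>Only the levels below \<open>length w\<close> are constrained, so that labellings can be
  built level by level.\<close>

definition labelling :: "('a \<Rightarrow> bool) \<Rightarrow> letter list \<Rightarrow> bool" where
  "labelling l w \<longleftrightarrow> (\<forall>i<length w. bij_betw l (level i) (labels (w ! i))) \<and>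
     (\<forall>i x y. Suc i < length w \<longrightarrow> x \<in> level i \<longrightarrow> y \<in> level (Suc i) \<longrightarrow>
        (x, y) \<in> r \<longleftrightarrow> edge (w ! Suc i) (l x) (l y))"

text \<open>Induction on the level. Equality of letters is strengthened by equality of labels on
  broken levels, which excludes a swap when \<open>normal_form_unique\<close> is applied to the next
  letter.\<close>

lemma labelling_unique:
  assumes l: "labelling l w" "code w" and l': "labelling l' w'" "code w'"
    and len: "length w = length w'"
  shows "w = w'"
proof -
  have bij: "bij_betw l (level i) (labels (w ! i))" "bij_betw l' (level i) (labels (w' ! i))"
    if "i < length w" for i using l l' len that by (auto simp: labelling_def)
  have "w ! i = w' ! i \<and> (broken (w ! i) \<longrightarrow> (\<forall>x\<in>level i. l' x = l x))" if "i < length w" for i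
    using that
  proof (induction i)
    case 0
    then show ?case using l l' by (auto simp: code_def broken_def)
  next
    case (Suc i)
    let ?d = "w ! i" and ?c = "w ! Suc i" and ?c' = "w' ! Suc i"
    have IH: "w' ! i = ?d" "broken ?d \<Longrightarrow> \<forall>x\<in>level i. l' x = l x" using Suc by auto
    have ok: "ok ?d ?c" "ok ?d ?c'" using l(2) l'(2) Suc.prems len IH(1) by (auto simp: code_def)
    \<comment> \<open>The size of the level decides whether its letter is
      \<open>One\<close>.\<close>
    have "card (labels ?c) = card (labels ?c')"
      using bij[OF Suc.prems] by (metis bij_betw_same_card)
    then have One: "?c = One \<longleftrightarrow> ?c' = One" by (auto simp: labels_def split: if_splits)
    consider "?c = One" | "?c \<noteq> One" "?d = One" | "?c \<noteq> One" "?d \<noteq> One" by blast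
    then show ?case
    proof cases
      case 1
      then show ?thesis using One by (auto simp: broken_def)
    next
      case 2
      \<comment> \<open>After \<open>One\<close>, \<open>ok\<close> allows only \<open>One\<close>
        and \<open>Full\<close>.\<close>
      then have "?c = Full" "?c' = Full" using ok One
        by (cases ?c; cases ?c'; simp add: symmetric_def broken_def)+
      then show ?thesis by (auto simp: broken_def)
    next
      case 3
      have bi: "bij_betw l (level i) UNIV" "bij_betw l' (level i) UNIV"
        using bij[of i] Suc.prems 3 IH(1) by (auto simp: labels_def)
      have bs: "bij_betw l (level (Suc i)) UNIV" "bij_betw l' (level (Suc i)) UNIV"
        using bij[OF Suc.prems] 3 One by (auto simp: labels_def)
      obtain s where s: "\<forall>x\<in>level i. l' x \<longleftrightarrow> l x \<noteq> s" using bij_bool_swap[OF bi] by blast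
      obtain t where t: "\<forall>x\<in>level (Suc i). l' x \<longleftrightarrow> l x \<noteq> t" using bij_bool_swap[OF bs] by blast
      have surj: "\<exists>x\<in>level i. l x = a" "\<exists>x\<in>level (Suc i). l x = a" for a
        using bi(1) bs(1) unfolding bij_betw_def by (metis UNIV_I imageE)+
      have "edge ?c a b \<longleftrightarrow> edge ?c' (a \<noteq> s) (b \<noteq> t)" for a b
      proof -
        obtain x y where x: "x \<in> level i" "l x = a" and y: "y \<in> level (Suc i)" "l y = b"
          using surj by blast
        have "(x, y) \<in> r \<longleftrightarrow> edge ?c (l x) (l y)" "(x, y) \<in> r \<longleftrightarrow> edge ?c' (l' x) (l' y)"
          using l(1) l'(1) x(1) y(1) Suc.prems len unfolding labelling_def by auto
        then show ?thesis using s t x y by simp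
      qed
      moreover have "broken ?d \<longrightarrow> \<not> s" using IH(2) s surj(1)[of True] by auto
      ultimately have "?c = ?c' \<and> (broken ?c \<longrightarrow> \<not> t)"
        using normal_form_unique[of ?c ?c' s t ?d] ok 3(1) One by blast
      then show ?thesis using t by auto
    qed
  qed
  then show ?thesis using len by (auto intro: nth_equalityI)
qed

lemma labelling_append:
  assumes l: "labelling l w" "length w = Suc i"
    and m: "bij_betw m (level (Suc i)) (labels c)"
    and e: "\<And>x y. x \<in> level i \<Longrightarrow> y \<in> level (Suc i) \<Longrightarrow> (x, y) \<in> r \<longleftrightarrow> edge c (l x) (m y)"
  shows "labelling (\<lambda>x. if rk x = Suc i then m x else l x) (w @ [c])" (is "labelling ?l _")
proof -
  have old: "?l x = l x" if "x \<in> level j" "j \<le> i" for x j using that by (auto simp: level_def)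
  have new: "?l x = m x" if "x \<in> level (Suc i)" for x using that by (auto simp: level_def)
  show ?thesis
    unfolding labelling_def
  proof (intro conjI allI impI)
    fix j assume "j < length (w @ [c])"
    then consider "j \<le> i" | "j = Suc i" using l(2) by force
    then show "bij_betw ?l (level j) (labels ((w @ [c]) ! j))"
    proof cases
      case 1
      then have "bij_betw l (level j) (labels (w ! j))" using l by (auto simp: labelling_def)
      then show ?thesis using 1 l(2) bij_betw_cong[of "level j" ?l l] old by (simp add: nth_append)
    next
      case 2
      then show ?thesis using m l(2) bij_betw_cong[of "level j" ?l m] new by (simp add: nth_append)
    qed
  next
    fix j x y assume j: "Suc j < length (w @ [c])" and x: "x \<in> level j" and y: "y \<in> level (Suc j)"
    then consider "j < i" | "j = i" using l(2) by force
    then show "(x, y) \<in> r \<longleftrightarrow> edge ((w @ [c]) ! Suc j) (?l x) (?l y)"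
    proof cases
      case 1
      then have "(x, y) \<in> r \<longleftrightarrow> edge (w ! Suc j) (l x) (l y)"
        using l x y unfolding labelling_def by auto
      then show ?thesis using 1 l(2) old[OF x] old[OF y] by (simp add: nth_append)
    next
      case 2
      then show ?thesis using e[of x y] l(2) x y old[OF x] new[of y] by (simp add: nth_append)
    qed
  qed
qed

lemma level_step_below: "y \<in> level (Suc i) \<Longrightarrow> \<exists>x\<in>level i. (x, y) \<in> r"
  using ex_below[of y i] by (auto simp: level_def)

lemma level_step_above: "x \<in> level i \<Longrightarrow> Suc i \<le> n \<Longrightarrow> \<exists>y\<in>level (Suc i). (x, y) \<in> r"
  using ex_above[of x "Suc i"] by (auto simp: level_def)

text \<open>Induction from bottom to top. The second labelling for a symmetric last letter supplies
  the swap that may be needed to bring the next letter into normal form.\<close>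

lemma labelling_exists:
  assumes two: "\<And>i. card (level i) \<le> 2" and "i \<le> n"
  shows "\<exists>w l. code w \<and> length w = Suc i \<and> labelling l w \<and>
    (symmetric (last w) \<longrightarrow> (\<exists>l'. labelling l' w \<and> (\<forall>x\<in>level i. l' x \<longleftrightarrow> \<not> l x)))"
  using assms(2)
proof (induction i)
  case 0
  obtain z where z: "level 0 = {z}" using level_0 by blast
  have "code [One]" by (simp add: code_def)
  moreover have "labelling (\<lambda>_. False) [One]"
    using z by (auto simp: labelling_def labels_def bij_betw_def)
  ultimately show ?case by (intro exI[of _ "[One]"] exI[of _ "\<lambda>_. False"]) (auto simp: symmetric_def)
next
  case (Suc i)
  then obtain w l where w: "code w" "length w = Suc i" "labelling l w"
    and flip: "symmetric (last w) \<Longrightarrow> \<exists>l'. labelling l' w \<and> (\<forall>x\<in>level i. l' x \<longleftrightarrow> \<not> l x)"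
    by auto
  have wne: "w \<noteq> []" and last: "last w = w ! i" using w(2) last_eq_nth by auto
  have bij: "bij_betw l (level i) (labels (last w))" using w last by (auto simp: labelling_def)
  have app: "code (w @ [c])" if "ok (last w) c" for c using that w(1) wne code_append by blast
  have "level (Suc i) \<noteq> {}" using level_eq_empty_iff Suc.prems by auto
  then have "card (level (Suc i)) = 1 \<or> card (level (Suc i)) = 2"
    using two[of "Suc i"] finite_level[of "Suc i"] card_gt_0_iff[of "level (Suc i)"] by linarith
  then consider z where "level (Suc i) = {z}"
    | m :: "'a \<Rightarrow> bool" where "bij_betw m (level (Suc i)) UNIV" "last w = One"
    | m :: "'a \<Rightarrow> bool" where "bij_betw m (level (Suc i)) UNIV" "last w \<noteq> One"
    using finite_level[of "Suc i"] finite_same_card_bij[of "level (Suc i)" "UNIV :: bool set"]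
    by (auto simp: card_1_singleton_iff)
  then show ?case
  proof cases
    case 1
    have "(x, z) \<in> r" if "x \<in> level i" for x using level_step_above[OF that] Suc.prems 1 by auto
    then have "labelling (\<lambda>x. if rk x = Suc i then False else l x) (w @ [One])"
      using 1 by (intro labelling_append[OF w(3,2)]) (auto simp: labels_def bij_betw_def)
    then show ?thesis using app[of One] w(2)
      by (intro exI[of _ "w @ [One]"] exI conjI) (auto simp: symmetric_def)
  next
    case 2
    then obtain z where z: "level i = {z}"
      using bij by (auto simp: labels_def dest!: bij_betw_same_card simp: card_1_singleton_iff)
    have full: "(x, y) \<in> r" if "x \<in> level i" "y \<in> level (Suc i)" for x y
      using level_step_below[OF that(2)] that(1) z by auto
    have "bij_betw (\<lambda>x. \<not> m x) (level (Suc i)) UNIV" (is ?nm)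
      using bij_betw_trans[OF 2(1), of Not UNIV] by (auto simp: bij_betw_def inj_on_def o_def surj_def)
    have ext: "labelling (\<lambda>x. if rk x = Suc i then k x else l x) (w @ [Full])"
      if "bij_betw k (level (Suc i)) UNIV" for k
      using that full by (intro labelling_append[OF w(3,2)]) (auto simp: labels_def)
    \<comment> \<open>\<open>Full\<close> accepts every labelling of the new level, so
      \<open>m\<close> and its negation give the required pair.\<close>
    show ?thesis using app[of Full] w(2) ext[OF 2(1)] ext[OF \<open>?nm\<close>]
      by (intro exI[of _ "w @ [Full]"] exI conjI) (auto simp: level_def)
  next
    case 3
    have bi: "bij_betw l (level i) UNIV" using bij 3(2) by (simp add: labels_def)
    let ?x = "inv_into (level i) l" and ?y = "inv_into (level (Suc i)) m"
    have x: "?x a \<in> level i" "l (?x a) = a" for a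
      using bi by (auto simp: bij_betw_def inv_into_into f_inv_into_f)
    have y: "?y a \<in> level (Suc i)" "m (?y a) = a" for a
      using 3(1) by (auto simp: bij_betw_def inv_into_into f_inv_into_f)
    have xl: "?x (l u) = u" if "u \<in> level i" for u using that bi by (auto simp: bij_betw_def)
    have ym: "?y (m u) = u" if "u \<in> level (Suc i)" for u using that 3(1) by (auto simp: bij_betw_def)
    define E where "E a b \<longleftrightarrow> (?x a, ?y b) \<in> r" for a b
    have "\<exists>b. E a b" for a
      using level_step_above[OF x(1)] Suc.prems ym unfolding E_def by metis
    moreover have "\<exists>a. E a b" for b
      using level_step_below[OF y(1)] xl unfolding E_def by metis
    ultimately obtain c where c: "c \<noteq> One" "ok (last w) c"
      "\<exists>s t. (broken (last w) \<longrightarrow> \<not> s) \<and> (\<forall>a b. E a b \<longleftrightarrow> edge c (a \<noteq> s) (b \<noteq> t))"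
      "symmetric c \<Longrightarrow> \<exists>s. (broken (last w) \<longrightarrow> \<not> s) \<and> (\<forall>a b. E a b \<longleftrightarrow> edge c (a \<noteq> s) (b \<noteq> t))" for t
      using normal_form_exists[of E "last w"] 3(2) by blast
    have ext: "\<exists>l'. labelling l' (w @ [c]) \<and> (\<forall>x\<in>level (Suc i). l' x \<longleftrightarrow> m x \<noteq> t)"
      if st: "broken (last w) \<longrightarrow> \<not> s" "\<forall>a b. E a b \<longleftrightarrow> edge c (a \<noteq> s) (b \<noteq> t)" for s t
    proof -
      \<comment> \<open>A swap \<open>s\<close> on the old level is realised by the second
        labelling: the last letter is neither broken nor \<open>One\<close>, hence
        symmetric.\<close>
      obtain l' where l': "labelling l' w" "\<forall>x\<in>level i. l' x \<longleftrightarrow> l x \<noteq> s"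
      proof (cases s)
        case True
        then have "symmetric (last w)" using st(1) 3(2)
          by (cases "last w") (auto simp: symmetric_def broken_def)
        then show ?thesis using flip that True by auto
      qed (use that w(3) in auto)
      have "bij_betw (\<lambda>x. x \<noteq> t) UNIV UNIV"
        by (cases t) (auto simp: bij_betw_def inj_on_def surj_def)
      then have "bij_betw (\<lambda>x. m x \<noteq> t) (level (Suc i)) (labels c)"
        using bij_betw_trans[OF 3(1), of "\<lambda>x. x \<noteq> t" UNIV] c(1) by (simp add: o_def labels_def)
      moreover have "(u, v) \<in> r \<longleftrightarrow> edge c (l' u) (m v \<noteq> t)"
        if "u \<in> level i" "v \<in> level (Suc i)" for u v
        using st(2)[rule_format, of "l u" "m v"] xl[OF that(1)] ym[OF that(2)] l'(2) that(1)
        by (simp add: E_def)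
      ultimately have "labelling (\<lambda>x. if rk x = Suc i then m x \<noteq> t else l' x) (w @ [c])"
        by (intro labelling_append[OF l'(1) w(2)]) auto
      then show ?thesis by (intro exI conjI) (auto simp: level_def)
    qed
    obtain t l1 where l1: "labelling l1 (w @ [c])" "\<forall>x\<in>level (Suc i). l1 x \<longleftrightarrow> m x \<noteq> t"
      using c(3) ext by blast
    moreover have "\<exists>l'. labelling l' (w @ [c]) \<and> (\<forall>x\<in>level (Suc i). l' x \<longleftrightarrow> \<not> l1 x)" if sym: "symmetric c"
    proof -
      \<comment> \<open>Prescribing the opposite swap on the new level produces the flipped
        labelling.\<close>
      obtain s where "broken (last w) \<longrightarrow> \<not> s" "\<forall>a b. E a b \<longleftrightarrow> edge c (a \<noteq> s) (b \<noteq> (\<not> t))"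
        using c(4)[OF sym, of "\<not> t"] by (elim exE conjE)
      from ext[OF this] obtain l2
        where "labelling l2 (w @ [c])" "\<forall>x\<in>level (Suc i). l2 x \<longleftrightarrow> m x \<noteq> (\<not> t)"
        by (elim exE conjE)
      then show ?thesis using l1(2) by (intro exI[of _ l2]) auto
    qed
    ultimately show ?thesis using app[OF c(2)] w(2)
      by (intro exI[of _ "w @ [c]"] exI[of _ l1]) auto
  qed
qed

text \<open>The isomorphism sends \<open>x\<close> to \<open>(rk x, l x)\<close>. The last letter is
  \<open>One\<close> because level \<open>n\<close> has one element.\<close>

lemma iso_code_poset:
  assumes "labelling l w" "code w" "length w = Suc n"
  shows "poset_iso r (code_poset w)" "last w = One"
proof -
  have bij: "bij_betw l (level i) (labels (w ! i))" if "i \<le> n" for i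
    using assms that by (auto simp: labelling_def)
  have wn: "last w = w ! n" using assms(3) by (rule last_eq_nth)
  have "card (labels (w ! n)) = 1" using bij[of n] level_n by (auto dest!: bij_betw_same_card)
  then show last: "last w = One" using wn by (auto simp: labels_def split: if_splits)
  let ?f = "\<lambda>x. (rk x, l x)"
  have f: "bij_betw ?f (Field r) (Field (code_poset w))"
    unfolding bij_betw_def
  proof (intro conjI equalityI subsetI)
    show "inj_on ?f (Field r)"
    proof (rule inj_onI)
      fix x y assume "x \<in> Field r" "y \<in> Field r" "?f x = ?f y"
      then show "x = y"
        using bij[of "rk x"] rk_le_n[of x] by (auto simp: bij_betw_def inj_on_def level_def)
    qed
    show "p \<in> Field (code_poset w)" if p: "p \<in> ?f ` Field r" for p
    proof -
      obtain x where x: "p = ?f x" "x \<in> Field r" using p by blast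
      then have "l x \<in> labels (w ! rk x)"
        using bij_betwE[OF bij[OF rk_le_n[OF x(2)]]] by (auto simp: level_def)
      then show ?thesis using x rk_le_n[OF x(2)] assms(3)
        by (auto simp: Field_code_poset code_carrier_def)
    qed
    show "p \<in> ?f ` Field r" if pF: "p \<in> Field (code_poset w)" for p
    proof -
      obtain i a where p: "p = (i, a)" "i \<le> n" "a \<in> labels (w ! i)"
        using pF assms(3) by (auto simp: Field_code_poset code_carrier_def)
      then have "a \<in> l ` level i" using bij[OF p(2)] by (simp add: bij_betw_def)
      then show ?thesis using p(1) by (auto simp: level_def)
    qed
  qed
  show "poset_iso r (code_poset w)"
  proof (rule poset_iso_by_covers[OF ranked_poset_axioms ranked_code_poset[OF assms(2,3) last] f])
    fix x y assume xy: "x \<in> Field r" "y \<in> Field r" "rk y = Suc (rk x)"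
    then have "?f x \<in> code_carrier w" "?f y \<in> code_carrier w"
      using bij_betwE[OF f] unfolding Field_code_poset by blast+
    then have "(?f x, ?f y) \<in> code_poset w \<longleftrightarrow> edge (w ! rk y) (l x) (l y)"
      using code_poset_step[of "?f x" w "?f y"] xy(3) by simp
    moreover have "Suc (rk x) < length w" using rk_le_n[OF xy(2)] xy(3) assms(3) by simp
    ultimately show "(x, y) \<in> r \<longleftrightarrow> (?f x, ?f y) \<in> code_poset w"
      using assms(1) xy unfolding labelling_def level_def by auto
  qed simp
qed

text \<open>The second component of an isomorphism is a labelling, because uniqueness of the rank
  function forces the first component to be the rank.\<close>

lemma labelling_of_iso:
  assumes w: "code w" "length w = Suc n" "last w = One" and "poset_iso r (code_poset w)"
  shows "\<exists>l. labelling l w"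
proof -
  obtain f where f: "bij_betw f (Field r) (Field (code_poset w))"
    "\<And>x y. x \<in> Field r \<Longrightarrow> y \<in> Field r \<Longrightarrow> (x, y) \<in> r \<longleftrightarrow> (f x, f y) \<in> code_poset w"
    using assms(4) by (auto simp: poset_iso_def)
  have "ranked_poset r n (fst \<circ> f)" by (rule ranked_poset_pullback[OF ranked_code_poset[OF w] f])
  then have rk: "fst (f x) = rk x" if "x \<in> Field r" for x
    using ranked_poset.poset_rank_eq[of r n "fst \<circ> f" x] poset_rank_eq[of x] that by simp
  have F: "f x \<in> code_carrier w" if "x \<in> Field r" for x
    using that f(1) by (auto simp: bij_betw_def Field_code_poset)
  have "labelling (snd \<circ> f) w"
    unfolding labelling_def
  proof (intro conjI allI impI)
    fix i assume i: "i < length w"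
    show "bij_betw (snd \<circ> f) (level i) (labels (w ! i))"
      unfolding bij_betw_def
    proof (intro conjI equalityI subsetI)
      show "inj_on (snd \<circ> f) (level i)"
      proof (rule inj_onI)
        fix x y assume "x \<in> level i" "y \<in> level i" "(snd \<circ> f) x = (snd \<circ> f) y"
        then have xy: "x \<in> Field r" "y \<in> Field r" "rk x = rk y" "snd (f x) = snd (f y)"
          by (auto simp: level_def)
        then have "f x = f y" using rk[of x] rk[of y] by (simp add: prod_eq_iff)
        then show "x = y" using f(1) xy by (meson bij_betw_def inj_onD)
      qed
      show "a \<in> labels (w ! i)" if "a \<in> (snd \<circ> f) ` level i" for a
      proof -
        obtain x where x: "x \<in> Field r" "rk x = i" "a = snd (f x)"
          using \<open>a \<in> (snd \<circ> f) ` level i\<close> by (auto simp: level_def)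
        then show ?thesis using F[of x] rk[of x] by (auto simp: code_carrier_def split: prod.splits)
      qed
      show "a \<in> (snd \<circ> f) ` level i" if "a \<in> labels (w ! i)" for a
      proof -
        have "(i, a) \<in> f ` Field r"
          using \<open>a \<in> labels (w ! i)\<close> i bij_betw_imp_surj_on[OF f(1)]
          by (simp add: Field_code_poset code_carrier_def)
        then obtain x where x: "x \<in> Field r" "f x = (i, a)" by auto
        then have "x \<in> level i" using rk[of x] by (simp add: level_def)
        then show ?thesis using x(2) by (intro image_eqI[of _ _ x]) auto
      qed
    qed
  next
    fix i x y assume "Suc i < length w" and x: "x \<in> level i" and y: "y \<in> level (Suc i)"
    then have xy: "x \<in> Field r" "y \<in> Field r" "fst (f x) = i" "fst (f y) = Suc i"
      using rk[of x] rk[of y] by (auto simp: level_def)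
    then show "(x, y) \<in> r \<longleftrightarrow> edge (w ! Suc i) ((snd \<circ> f) x) ((snd \<circ> f) y)"
      using f(2)[OF xy(1,2)] code_poset_step[OF F[OF xy(1)] F[OF xy(2)]] by simp
  qed
  then show ?thesis by blast
qed

end

section \<open>Counting codes\<close>

unbundle fps_syntax

text \<open>The \<open>Suc n\<close> letters stand for the ranks 0 to \<open>n\<close>. The last
  letter is a parameter for the sake of the recursion; posets correspond to
  \<open>One\<close>.\<close>

definition codes :: "nat \<Rightarrow> letter \<Rightarrow> letter list set" where
  "codes n c = {w. code w \<and> length w = Suc n \<and> last w = c}"

definition weight :: "letter list \<Rightarrow> nat" where
  "weight w = sum_list (map (\<lambda>c. card (labels c)) w)"

lemma finite_codes: "finite (codes n c)"
proof -
  have "finite (UNIV :: letter set)" by (simp add: UNIV_letter)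
  then have "finite {w :: letter list. set w \<subseteq> UNIV \<and> length w = Suc n}"
    by (rule finite_lists_length_eq)
  then show ?thesis by (rule rev_finite_subset) (auto simp: codes_def)
qed

lemma card_code_carrier: "card (code_carrier w) = weight w"
proof -
  have "code_carrier w = Sigma {..<length w} (\<lambda>i. labels (w ! i))"
    by (auto simp: code_carrier_def)
  then have "card (code_carrier w) = (\<Sum>i<length w. card (labels (w ! i)))" by simp
  also have "\<dots> = weight w"
    by (simp add: weight_def sum_list_sum_nth atLeast0LessThan)
  finally show ?thesis .
qed

section \<open>Codes as representatives of isomorphism types\<close>

lemma narrow_code_poset:
  assumes "w \<in> codes n One"
  shows "narrow n (code_poset w)"
proof -
  interpret ranked_poset "code_poset w" n fst
    using assms by (intro ranked_code_poset) (auto simp: codes_def)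
  have "card (level i) \<le> 2" for i
  proof -
    have "card (level i) \<le> card ({i} \<times> (UNIV :: bool set))"
      by (rule card_mono) (auto simp: level_def)
    then show ?thesis by simp
  qed
  then show ?thesis using ranked_poset_axioms by (auto simp: narrow_def)
qed

lemma narrow_iso_code:
  assumes "narrow n r"
  shows "\<exists>w\<in>codes n One. poset_iso r (code_poset w)"
proof -
  obtain rk where rk: "ranked_poset r n rk" "\<And>i. card (ranked_poset.level r rk i) \<le> 2"
    using assms by (auto simp: narrow_def)
  interpret ranked_poset r n rk by fact
  obtain w l where w: "code w" "length w = Suc n" "labelling l w"
    using labelling_exists[OF rk(2), of n] by blast
  then show ?thesis using iso_code_poset[OF w(3,1,2)] by (auto simp: codes_def)
qed

lemma narrow_iso_code_unique:
  assumes "narrow n r" "w \<in> codes n One" "w' \<in> codes n One"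
    and "poset_iso r (code_poset w)" "poset_iso r (code_poset w')"
  shows "w = w'"
proof -
  obtain rk where "ranked_poset r n rk" using assms(1) by (auto simp: narrow_def)
  then interpret ranked_poset r n rk .
  show ?thesis
    using assms labelling_of_iso[of w] labelling_of_iso[of w'] labelling_unique[of _ w _ w']
    by (auto simp: codes_def)
qed

lemma poset_iso_card: "poset_iso r s \<Longrightarrow> card (Field r) = card (Field s)"
  by (auto simp: poset_iso_def bij_betw_same_card)

text \<open>\<open>G w\<close> is the isomorphism class of \<open>code_poset w\<close> on the
  carrier \<open>{..<k}\<close>, and \<open>G\<close> is a bijection from codes to classes.
  \<open>poset_iso_standard_carrier\<close> makes each \<open>G w\<close> nonempty, as injectivity
  requires.\<close>

lemma num_mf_posets_eq: "num_mf_posets n k = card {w \<in> codes n One. weight w = k}"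
proof -
  let ?A = "mf_posets n k" and ?W = "{w \<in> codes n One. weight w = k}"
  let ?R = "{(r, s). r \<in> ?A \<and> s \<in> ?A \<and> poset_iso r s}"
  define G where "G w = {r \<in> ?A. poset_iso r (code_poset w)}" for w
  have nar: "narrow n r" if "r \<in> ?A" for r using that by (simp add: mf_posets_eq)
  have ne: "\<exists>r. r \<in> G w" if w: "w \<in> ?W" for w
  proof -
    have "narrow n (code_poset w)" using w narrow_code_poset by blast
    then have "Partial_order (code_poset w)" by (auto simp: narrow_def ranked_poset_def)
    moreover have "finite (Field (code_poset w))" "card (Field (code_poset w)) = k"
      using w finite_code_carrier card_code_carrier by (auto simp: Field_code_poset)
    ultimately obtain s :: "nat rel" where s: "Field s = {..<k}" "poset_iso (code_poset w) s"
      using poset_iso_standard_carrier by metis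
    then have "poset_iso s (code_poset w)" using poset_iso_sym by blast
    then have "s \<in> G w"
      using narrow_iso[OF \<open>narrow n (code_poset w)\<close>] s(1) by (simp add: G_def mf_posets_eq)
    then show ?thesis ..
  qed
  have cls: "?R `` {r} = G w" if "r \<in> G w" for r w
  proof -
    have r: "r \<in> ?A" "poset_iso r (code_poset w)" using that by (auto simp: G_def)
    have "poset_iso r s \<longleftrightarrow> poset_iso s (code_poset w)" for s :: "nat rel"
      by (meson r(2) poset_iso_trans poset_iso_sym)
    then show ?thesis using r(1) by (auto simp: G_def)
  qed
  have "?A // ?R = G ` ?W"
  proof (intro equalityI subsetI)
    fix X assume "X \<in> ?A // ?R"
    then obtain r where r: "r \<in> ?A" "X = ?R `` {r}" by (auto simp: quotient_def)
    obtain w where w: "w \<in> codes n One" "poset_iso r (code_poset w)"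
      using narrow_iso_code[OF nar[OF r(1)]] by blast
    have "weight w = k"
      using poset_iso_card[OF w(2)] r(1)
      by (simp add: Field_code_poset card_code_carrier mf_posets_eq)
    moreover have "r \<in> G w" using r(1) w(2) by (simp add: G_def)
    ultimately show "X \<in> G ` ?W" using cls r(2) w(1) by auto
  next
    fix X assume "X \<in> G ` ?W"
    then obtain w where w: "w \<in> ?W" "X = G w" by blast
    then obtain r where "r \<in> G w" using ne by blast
    then have "X = ?R `` {r}" "r \<in> ?A" using cls w(2) by (auto simp: G_def)
    then show "X \<in> ?A // ?R" by (auto simp: quotient_def)
  qed
  moreover have "inj_on G ?W"
  proof (rule inj_onI)
    fix w w' assume w: "w \<in> ?W" "w' \<in> ?W" "G w = G w'"
    then obtain r where "r \<in> G w" "r \<in> G w'" using ne by blast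
    then show "w = w'" using w nar narrow_iso_code_unique[of n r w w'] by (auto simp: G_def)
  qed
  ultimately show ?thesis by (simp add: num_mf_posets_def card_image)
qed

section \<open>Generating functions of codes by last letter\<close>

definition code_gf :: "nat \<Rightarrow> letter \<Rightarrow> rat fps" where
  "code_gf n c = (\<Sum>w\<in>codes n c. fps_X ^ weight w)"

lemma code_gf_nth: "code_gf n c $ k = of_nat (card {w \<in> codes n c. weight w = k})"
proof -
  have "code_gf n c $ k = (\<Sum>w\<in>codes n c. if weight w = k then 1 else 0)"
    by (auto simp: code_gf_def fps_sum_nth fps_X_power_nth intro!: sum.cong)
  also have "\<dots> = of_nat (card {w \<in> codes n c. weight w = k})"
    using finite_codes[of n c] by (simp add: sum.If_cases Int_def)
  finally show ?thesis .
qed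

lemma code_gf_0: "code_gf 0 c = (if c = One then fps_X else 0)"
proof -
  have "codes 0 c = (if c = One then {[One]} else {})"
    by (auto simp: codes_def code_def length_Suc_conv)
  then show ?thesis by (simp add: code_gf_def weight_def labels_def)
qed

lemma codes_Suc: "codes (Suc n) c = (\<Union>d\<in>{d. ok d c}. (\<lambda>w. w @ [c]) ` codes n d)"
proof (intro equalityI subsetI)
  fix w assume w: "w \<in> codes (Suc n) c"
  then obtain v where v: "w = v @ [c]"
    by (cases w rule: rev_cases) (auto simp: codes_def)
  then have "v \<noteq> []" using w by (auto simp: codes_def)
  then show "w \<in> (\<Union>d\<in>{d. ok d c}. (\<lambda>w. w @ [c]) ` codes n d)"
    using w v by (auto simp: codes_def code_append)
next
  fix w assume "w \<in> (\<Union>d\<in>{d. ok d c}. (\<lambda>w. w @ [c]) ` codes n d)"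
  then obtain v where v: "w = v @ [c]" "v \<in> codes n (last v)" "ok (last v) c"
    by (auto simp: codes_def)
  moreover have "v \<noteq> []" using v by (auto simp: codes_def)
  ultimately show "w \<in> codes (Suc n) c" by (auto simp: codes_def code_append)
qed

text \<open>One step of the automaton. The union in \<open>codes_Suc\<close> is disjoint because the
  shortened word determines the state \<open>d\<close>.\<close>

lemma code_gf_Suc:
  "code_gf (Suc n) c = fps_X ^ card (labels c) * (\<Sum>d\<in>{d. ok d c}. code_gf n d)"
proof -
  have "finite (UNIV :: letter set)" by (simp add: UNIV_letter)
  then have fin: "finite {d. ok d c}" by (rule rev_finite_subset) simp
  have "code_gf (Suc n) c = (\<Sum>d\<in>{d. ok d c}. \<Sum>w\<in>(\<lambda>w. w @ [c]) ` codes n d. fps_X ^ weight w)"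
    unfolding code_gf_def codes_Suc
    by (rule sum.UNION_disjoint) (use fin finite_codes in \<open>auto simp: codes_def\<close>)
  also have "\<dots> = (\<Sum>d\<in>{d. ok d c}. fps_X ^ card (labels c) * code_gf n d)"
    by (intro sum.cong refl, subst sum.reindex)
      (auto simp: inj_on_def code_gf_def weight_def power_add mult.commute sum_distrib_left)
  finally show ?thesis by (simp add: sum_distrib_left)
qed

text \<open>The index \<open>n\<close> is the exponent of \<open>varx\<close>; the coefficients are
  series in the inner \<open>fps_X\<close>, the variable behind \<open>vary\<close>.\<close>

definition code_series :: "letter \<Rightarrow> rat fps fps" where
  "code_series c = Abs_fps (\<lambda>n. code_gf n c)"

text \<open>The summand \<open>vary\<close> is the word \<open>[One]\<close>; each further letter
  adds one rank and \<open>card (labels c)\<close> elements.\<close>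

lemma code_series_eq:
  "code_series c = (if c = One then vary else 0) +
     varx * vary ^ card (labels c) * (\<Sum>d\<in>{d. ok d c}. code_series d)"
proof (rule fps_ext)
  fix n
  define k where "k = card (labels c)"
  define T where "T = (\<Sum>d\<in>{d. ok d c}. code_series d)"
  have T: "T $ m = (\<Sum>d\<in>{d. ok d c}. code_gf m d)" for m
    by (simp add: T_def fps_sum_nth code_series_def)
  have "varx * vary ^ k * T = fps_X * (fps_const (fps_X ^ k) * T)"
    by (simp only: varx_def vary_def fps_const_power mult.assoc)
  then have step: "(varx * vary ^ k * T) $ n = (if n = 0 then 0 else fps_X ^ k * T $ (n - 1))"
    by (simp only: fps_X_mult_nth fps_mult_left_const_nth)
  have v: "(if c = One then vary else 0) $ n = (if n = 0 \<and> c = One then fps_X else 0)"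
    by (simp add: vary_def)
  have "code_series c $ n = code_gf n c" by (simp add: code_series_def)
  also have "\<dots> = (if n = 0 \<and> c = One then fps_X else 0) +
      (if n = 0 then 0 else fps_X ^ k * T $ (n - 1))"
    by (cases n) (simp_all only: code_gf_0 code_gf_Suc T k_def, simp_all)
  finally show "code_series c $ n = ((if c = One then vary else 0) +
     varx * vary ^ card (labels c) * (\<Sum>d\<in>{d. ok d c}. code_series d)) $ n"
    by (simp only: fps_add_nth v step k_def[symmetric] T_def[symmetric])
qed

text \<open>Subtracting \<open>vary\<close> removes the one-element poset of rank 0. Words for
  positive rank have at least two letters, hence weight at least 2, which matches the range of
  \<open>k\<close>.\<close>

lemma U_series_eq: "U_series = code_series One - vary"
proof (intro fps_ext)
  fix n k
  show "U_series $ n $ k = (code_series One - vary) $ n $ k"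
  proof (cases n)
    case 0
    then show ?thesis by (simp add: U_series_def code_series_def vary_def code_gf_0)
  next
    case (Suc m)
    have "weight w \<ge> 2" if "w \<in> codes n One" for w
    proof -
      have "length w = Suc (Suc m)" using that Suc by (simp add: codes_def)
      then obtain a b v where "w = a # b # v" by (auto simp: length_Suc_conv)
      moreover have "card (labels c) \<ge> 1" for c by (simp add: labels_def)
      ultimately show ?thesis using add_mono[of 1 "card (labels a)" 1 "card (labels b)"]
        by (simp add: weight_def)
    qed
    then have "{w \<in> codes n One. weight w = k} = {}" if "k < 2" using that by force
    then have "k < 2 \<Longrightarrow> card {w \<in> codes n One. weight w = k} = 0" by (metis card.empty)
    then show ?thesis using Suc
      by (auto simp: U_series_nth code_series_def vary_def code_gf_nth num_mf_posets_eq not_le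
          simp del: card_eq_0_iff)
  qed
qed

theorem theorem4p2:
  shows "U_series =
    (varx * vary ^ 2 * (1 - varx * vary ^ 2) * (1 - 3 * varx * vary ^ 2)) /
    (1 - varx * vary - 5 * varx * vary ^ 2 + 4 * varx ^ 2 * vary ^ 3
       + 5 * varx ^ 2 * vary ^ 4 - 3 * varx ^ 3 * vary ^ 5)"
    (is "_ = ?N / ?D")
proof -
  define A S B where "A = code_series One"
    and "S = code_series Full + code_series MatchS"
    and "B = code_series MatchB + code_series Up + code_series Down"
  define x y where "x = varx" and "y = vary"
  \<comment> \<open>Every set of predecessors is a union of states, so the equations close up in
    \<open>A\<close>, \<open>S\<close> and \<open>B\<close>.\<close>
  have ok_sets: "{d. ok d One} = {One, Full, MatchS, MatchB, Up, Down}"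
    "{d. ok d Full} = {One, Full, MatchS, MatchB, Up, Down}"
    "{d. ok d MatchS} = {Full, MatchS}" "{d. ok d MatchB} = {MatchB, Up, Down}"
    "{d. ok d Up} = {Full, MatchS, MatchB, Up, Down}" "{d. ok d Down} = {MatchB, Up, Down}"
    using UNIV_letter by (auto simp: symmetric_def broken_def)
  have card_labels: "card (labels c) = (if c = One then 1 else 2)" for c by (simp add: labels_def)
  have eqs: "code_series One = y + x * y * (A + S + B)"
    "code_series Full = x * y ^ 2 * (A + S + B)" "code_series MatchS = x * y ^ 2 * S"
    "code_series MatchB = x * y ^ 2 * B" "code_series Up = x * y ^ 2 * (S + B)"
    "code_series Down = x * y ^ 2 * B"
    by (rule trans[OF code_series_eq], subst ok_sets,
        simp add: card_labels A_def S_def B_def x_def y_def add.assoc)+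
  define s z where "s = x * y" and "z = x * y ^ 2"
  have A: "A = y + s * (A + S + B)"
    using A_def eqs(1) unfolding s_def by (rule trans)
  have "code_series Full + code_series MatchS = z * (A + S + B) + z * S"
    by (simp only: eqs z_def)
  with S_def have S: "S = z * (A + S + B) + z * S" by (rule trans)
  have "code_series MatchB + code_series Up + code_series Down = z * B + z * (S + B) + z * B"
    by (simp only: eqs z_def)
  with B_def have B: "B = z * B + z * (S + B) + z * B" by (rule trans)
  \<comment> \<open>\<open>Q\<close> is the determinant
    \<open>(1 - 2 * z) * (1 - 3 * z) - z ^ 2\<close> of the linear equations for \<open>S\<close>
    and \<open>B\<close>.\<close>
  define Q where "Q = 1 - 5 * z + 5 * z ^ 2"
  have "Q * S = z * (1 - 3 * z) * A" using S B Q_def by algebra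
  \<comment> \<open>\<open>B\<close> is eliminated through
    \<open>(1 - 3 * z) * B = z * S\<close>.\<close>
  moreover have "(1 - 3 * z) * (1 - s) * A = (1 - 3 * z) * y + s * (1 - 2 * z) * S"
    using A B by algebra
  ultimately have "(1 - 3 * z) * (A * (Q * (1 - s) - s * z * (1 - 2 * z))) = (1 - 3 * z) * (Q * y)"
    by algebra
  \<comment> \<open>The common factor has constant term 1 in \<open>varx\<close>, so it is nonzero
    and can be cancelled.\<close>
  moreover have "(1 - 3 * z) $ 0 = 1" by (simp add: z_def x_def varx_def)
  then have "1 - 3 * z \<noteq> 0" by (metis fps_zero_nth zero_neq_one)
  ultimately have "A * (Q * (1 - s) - s * z * (1 - 2 * z)) = Q * y" by (metis mult_left_cancel)
  moreover have "U_series = A - y" by (simp add: U_series_eq A_def y_def)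
  \<comment> \<open>The factor of \<open>A\<close> expands to \<open>?D\<close>, and
    \<open>y * (Q - ?D)\<close> factors as \<open>?N\<close>.\<close>
  ultimately have "U_series * ?D = ?N"
    unfolding Q_def s_def z_def x_def[symmetric] y_def[symmetric] by algebra
  \<comment> \<open>The constant term 1 makes the division by \<open>?D\<close> exact.\<close>
  moreover have D0: "?D $ 0 = 1" by (simp add: varx_def)
  then have "?N / ?D * ?D = ?N" by (rule fps_fps_divide_cancel)
  moreover have "?D \<noteq> 0" using D0 by (metis fps_zero_nth zero_neq_one)
  ultimately show ?thesis by (metis mult_right_cancel)
qed

end
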